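(* Assume that the field $\Bbbk$ contains a primitive $6$-th root of unity $\zeta$. Consider the Hopf algebra $$A=\Bbbk\langle a,b,x\mid a^2=1=b^6,\ x^2=0,\ ab=ba,\ ax=xa,\ bx=-xb\rangle$$ and let $R$ be the subalgebra of $A$ generated by $x$. For $0\le m,s\le1$, $0\le t\le5$ set $N_{s,t,m}:=e_{s,t}x^mR$. Then the $N_{s,t,m}$ form an irredundant set of representatives of $\mathcal{L}_{\mathrm{in}}(A_A)$ (that is, every indecomposable right ideal of $A$ is isomorphic, as a right $A$-module, to exactly one of the $N_{s,t,m}$, each of which is itself an indecomposable right ideal), and $$\mathcal{L}_{\mathrm{in}}(A_A)=\{(1+rx)N_{s,t,m}\mid r\in R,\ 0\le m,s\le1,\ 0\le t\le5\}.$$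
   Context: $e_0=\frac12(1+a)$, $e_1=\frac12(1-a)$, $f_j=\frac16\sum_{i=0}^5\zeta^{ji}b^i$ for $j\in\mathbb{Z}$, and $e_{i,j}:=e_if_j$. The set $\{x^me_{i,j}\mid 0\le m,i\le1,\ 0\le j\le5\}$ is a $\Bbbk$-basis of $A$ (so $\dim_\Bbbk A=24$). $\mathcal{L}_{\mathrm{in}}(A_A)$ denotes the set of right ideals of $A$ that are indecomposable as right $A$-modules (in particular non-zero). (The Hopf algebra structure, not needed for the statement, is $\Delta(a)=a\otimes a$, $\Delta(b)=b\otimes e_0b+b^{-1}\otimes e_1b$, $\Delta(x)=b^3\otimes x+x\otimes1$, $\varepsilon(a)=\varepsilon(b)=1$, $\varepsilon(x)=0$.) *)

theory Defs
  imports Complex_Main "HOL-Library.Poly_Mapping"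
begin

subsection \<open>The free algebra on three generators\<close>

datatype generator = GenA | GenB | GenX

datatype word = Word (letters: "generator list")

instantiation word :: monoid_add
begin

definition zero_word :: word where "0 = Word []"

definition plus_word :: "word \<Rightarrow> word \<Rightarrow> word"
  where "u + v = Word (letters u @ letters v)"

instance
  by standard (auto simp: zero_word_def plus_word_def)

end

text \<open>
  The monoid of words is written additively, so that the convolution product of
  \<^theory>\<open>HOL-Library.Poly_Mapping\<close> turns the finitely supported functions
  on words into the free associative unital algebra.
\<close>

type_synonym 'k free_alg = "word \<Rightarrow>\<^sub>0 'k"

lemma free_alg_induct [case_names zero add_single]:
  fixes p :: "'k::field free_alg"
  assumes "P 0" "\<And>p w c. P p \<Longrightarrow> P (p + Poly_Mapping.single w c)"
  shows "P p"
proof (induction p rule: update_induct)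
  case const
  then show ?case by (rule assms(1))
next
  case (update p w c)
  have "Poly_Mapping.update w c p = p + Poly_Mapping.single w c"
    using update(1)
    by (intro poly_mapping_eqI) (auto simp: lookup_update lookup_add lookup_single in_keys_iff when_def)
  then show ?case using assms(2) update(3) by simp
qed

definition free_gen :: "generator \<Rightarrow> 'k::field free_alg"
  where "free_gen g = Poly_Mapping.single (Word [g]) 1"

definition free_const :: "'k \<Rightarrow> 'k::field free_alg"
  where "free_const c = Poly_Mapping.single 0 c"

definition relators :: "'k::field free_alg set"
  where "relators =
    (let a = free_gen GenA; b = free_gen GenB; x = free_gen GenX
     in {a ^ 2 - 1, b ^ 6 - 1, x ^ 2, a * b - b * a, a * x - x * a, b * x + x * b})"

definition two_sided_ideal :: "'a::ring_1 set \<Rightarrow> bool"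
  where "two_sided_ideal I \<longleftrightarrow>
    0 \<in> I \<and> (\<forall>u\<in>I. \<forall>v\<in>I. u + v \<in> I) \<and> (\<forall>u\<in>I. \<forall>r. r * u \<in> I \<and> u * r \<in> I)"

definition relation_ideal :: "'k::field free_alg set"
  where "relation_ideal = two_sided_ideal hull relators"

lemma two_sided_ideal_relation_ideal: "two_sided_ideal relation_ideal"
  unfolding relation_ideal_def by (rule hull_in) (auto simp: two_sided_ideal_def)

lemma relators_subset_relation_ideal: "relators \<subseteq> relation_ideal"
  unfolding relation_ideal_def by (rule hull_subset)

lemma relation_ideal_0: "0 \<in> relation_ideal"
  and relation_ideal_add: "u \<in> relation_ideal \<Longrightarrow> v \<in> relation_ideal \<Longrightarrow> u + v \<in> relation_ideal"
  and relation_ideal_mult_left: "u \<in> relation_ideal \<Longrightarrow> r * u \<in> relation_ideal"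
  and relation_ideal_mult_right: "u \<in> relation_ideal \<Longrightarrow> u * r \<in> relation_ideal"
  using two_sided_ideal_relation_ideal unfolding two_sided_ideal_def by blast+

lemma relation_ideal_uminus: "u \<in> relation_ideal \<Longrightarrow> - u \<in> relation_ideal"
  using relation_ideal_mult_left[of u "- 1"] by simp

text \<open>
  The augmentation \<open>a, b \<mapsto> 1\<close>, \<open>x \<mapsto> 0\<close> is used only to see
  that the quotient is not the zero ring.
\<close>

definition word_counit :: "word \<Rightarrow> 'k::field"
  where "word_counit w = (if GenX \<in> set (letters w) then 0 else 1)"

definition free_counit :: "'k::field free_alg \<Rightarrow> 'k"
  where "free_counit p = (\<Sum>w\<in>Poly_Mapping.keys p. Poly_Mapping.lookup p w * word_counit w)"

lemma word_counit_add: "word_counit (u + v) = word_counit u * word_counit v"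
  by (auto simp: word_counit_def plus_word_def)

lemma free_counit_superset:
  assumes "finite S" "Poly_Mapping.keys p \<subseteq> S"
  shows "free_counit p = (\<Sum>w\<in>S. Poly_Mapping.lookup p w * word_counit w)"
  unfolding free_counit_def
  by (rule sum.mono_neutral_left) (use assms in \<open>auto simp: in_keys_iff\<close>)

lemma free_counit_single: "free_counit (Poly_Mapping.single w c) = c * word_counit w"
  by (subst free_counit_superset[of "{w}"]) auto

lemma free_counit_0: "free_counit 0 = 0"
  by (simp add: free_counit_def)

lemma free_counit_add: "free_counit (p + q) = free_counit p + free_counit q"
proof -
  let ?S = "Poly_Mapping.keys p \<union> Poly_Mapping.keys q"
  have "Poly_Mapping.keys (p + q) \<subseteq> ?S" by (rule Poly_Mapping.keys_add)
  then show ?thesis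
    by (subst (1 2 3) free_counit_superset[of ?S])
       (auto simp: lookup_add algebra_simps sum.distrib)
qed

lemma free_counit_mult_single:
  "free_counit (Poly_Mapping.single w c * q) = c * word_counit w * free_counit q"
proof (induction q rule: free_alg_induct)
  case zero
  show ?case by (simp add: free_counit_0)
next
  case (add_single q v d)
  then show ?case
    by (simp add: distrib_left free_counit_add mult_single free_counit_single word_counit_add)
qed

lemma free_counit_mult: "free_counit (p * q) = free_counit p * free_counit q"
proof (induction p rule: free_alg_induct)
  case zero
  show ?case by (simp add: free_counit_0)
next
  case (add_single p v d)
  then show ?case
    by (simp add: distrib_right free_counit_add free_counit_mult_single free_counit_single)
qed

lemma free_counit_1: "free_counit 1 = 1"
  by (simp add: single_one[symmetric] free_counit_single word_counit_def zero_word_def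
           del: single_one)

lemma free_counit_power: "free_counit (p ^ n) = free_counit p ^ n"
  by (induction n) (simp_all add: free_counit_1 free_counit_mult)

lemma free_counit_gen: "free_counit (free_gen g) = (if g = GenX then 0 else 1)"
  by (auto simp: free_gen_def free_counit_single word_counit_def)

lemma free_counit_uminus: "free_counit (- p) = - free_counit p"
  using free_counit_add[of p "- p"] by (simp add: free_counit_0 add_eq_0_iff)

lemma free_counit_diff: "free_counit (p - q) = free_counit p - free_counit q"
  using free_counit_add[of p "- q"] by (simp add: free_counit_uminus)

lemma one_notin_relation_ideal: "(1 :: 'k::field free_alg) \<notin> relation_ideal"
proof
  let ?I = "{p :: 'k free_alg. free_counit p = 0}"
  assume "(1 :: 'k free_alg) \<in> relation_ideal"
  moreover have "two_sided_ideal ?I"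
    by (auto simp: two_sided_ideal_def free_counit_0 free_counit_add free_counit_mult)
  moreover have "relators \<subseteq> ?I"
    by (auto simp: relators_def Let_def free_counit_add free_counit_diff free_counit_mult
        free_counit_power free_counit_1 free_counit_gen)
  ultimately have "1 \<in> ?I" unfolding relation_ideal_def hull_def by blast
  then show False by (simp add: free_counit_1)
qed

subsection \<open>The algebra \<open>A\<close>\<close>

definition rel_cong :: "'k::field free_alg \<Rightarrow> 'k free_alg \<Rightarrow> bool"
  where "rel_cong p q \<longleftrightarrow> p - q \<in> relation_ideal"

lemma equivp_rel_cong: "equivp (rel_cong :: 'k::field free_alg \<Rightarrow> _)" (is "equivp ?R")
proof (rule equivpI)
  show "reflp ?R" by (simp add: reflp_def rel_cong_def relation_ideal_0)
  show "symp ?R"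
  proof (rule sympI)
    fix p q :: "'k free_alg"
    assume "rel_cong p q"
    then have "- (p - q) \<in> relation_ideal"
      unfolding rel_cong_def by (rule relation_ideal_uminus)
    then show "rel_cong q p" by (simp add: rel_cong_def)
  qed
  show "transp ?R"
  proof (rule transpI)
    fix p q r :: "'k free_alg"
    assume "rel_cong p q" "rel_cong q r"
    then have "(p - q) + (q - r) \<in> relation_ideal"
      unfolding rel_cong_def by (rule relation_ideal_add)
    then show "rel_cong p r" by (simp add: rel_cong_def)
  qed
qed

quotient_type (overloaded) 'k algA = "'k::field free_alg" / rel_cong
  by (rule equivp_rel_cong)

instantiation algA :: (field) ring_1
begin

lift_definition zero_algA :: "'a algA" is 0 .

lift_definition one_algA :: "'a algA" is 1 .

lift_definition plus_algA :: "'a algA \<Rightarrow> 'a algA \<Rightarrow> 'a algA" is "(+)"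
proof -
  fix p p' q q' :: "'a free_alg"
  assume "rel_cong p p'" "rel_cong q q'"
  then have "(p - p') + (q - q') \<in> relation_ideal"
    unfolding rel_cong_def by (rule relation_ideal_add)
  then show "rel_cong (p + q) (p' + q')" by (simp add: rel_cong_def algebra_simps)
qed

lift_definition uminus_algA :: "'a algA \<Rightarrow> 'a algA" is uminus
proof -
  fix p p' :: "'a free_alg"
  assume "rel_cong p p'"
  then have "- (p - p') \<in> relation_ideal"
    unfolding rel_cong_def by (rule relation_ideal_uminus)
  then show "rel_cong (- p) (- p')" by (simp add: rel_cong_def)
qed

lift_definition minus_algA :: "'a algA \<Rightarrow> 'a algA \<Rightarrow> 'a algA" is "(-)"
proof -
  fix p p' q q' :: "'a free_alg"
  assume "rel_cong p p'" "rel_cong q q'"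
  then have "(p - p') + - (q - q') \<in> relation_ideal"
    unfolding rel_cong_def by (intro relation_ideal_add relation_ideal_uminus)
  then show "rel_cong (p - q) (p' - q')" by (simp add: rel_cong_def algebra_simps)
qed

lift_definition times_algA :: "'a algA \<Rightarrow> 'a algA \<Rightarrow> 'a algA" is "(*)"
proof -
  fix p p' q q' :: "'a free_alg"
  assume "rel_cong p p'" "rel_cong q q'"
  then have "(p - p') * q + p' * (q - q') \<in> relation_ideal"
    unfolding rel_cong_def
    by (intro relation_ideal_add relation_ideal_mult_left relation_ideal_mult_right)
  then show "rel_cong (p * q) (p' * q')" by (simp add: rel_cong_def algebra_simps)
qed

instance
proof
  fix u v w :: "'a algA"
  show "u + v + w = u + (v + w)"
    by transfer (simp add: rel_cong_def relation_ideal_0 algebra_simps)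
  show "u + v = v + u"
    by transfer (simp add: rel_cong_def relation_ideal_0 algebra_simps)
  show "0 + u = u"
    by transfer (simp add: rel_cong_def relation_ideal_0)
  show "- u + u = 0"
    by transfer (simp add: rel_cong_def relation_ideal_0)
  show "u - v = u + - v"
    by transfer (simp add: rel_cong_def relation_ideal_0)
  show "u * v * w = u * (v * w)"
    by transfer (simp add: rel_cong_def relation_ideal_0 mult.assoc)
  show "1 * u = u"
    by transfer (simp add: rel_cong_def relation_ideal_0)
  show "u * 1 = u"
    by transfer (simp add: rel_cong_def relation_ideal_0)
  show "(u + v) * w = u * w + v * w"
    by transfer (simp add: rel_cong_def relation_ideal_0 algebra_simps)
  show "u * (v + w) = u * v + u * w"
    by transfer (simp add: rel_cong_def relation_ideal_0 algebra_simps)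
  show "(0 :: 'a algA) \<noteq> 1"
  proof transfer
    show "\<not> rel_cong (0 :: 'a free_alg) 1"
      using relation_ideal_uminus[of "- 1 :: 'a free_alg"] one_notin_relation_ideal
      by (auto simp: rel_cong_def)
  qed
qed

end

lift_definition gen_a :: "'k::field algA" is "free_gen GenA" .

lift_definition gen_b :: "'k::field algA" is "free_gen GenB" .

lift_definition gen_x :: "'k::field algA" is "free_gen GenX" .

lift_definition scal :: "'k::field \<Rightarrow> 'k algA \<Rightarrow> 'k algA" is "\<lambda>c p. free_const c * p"
  unfolding rel_cong_def right_diff_distrib[symmetric] by (rule relation_ideal_mult_left)

global_interpretation algA: vector_space "scal :: 'k::field \<Rightarrow> 'k algA \<Rightarrow> 'k algA"
proof
  fix c d :: 'k and u v :: "'k algA"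
  show "scal c (u + v) = scal c u + scal c v"
    by transfer (simp add: rel_cong_def relation_ideal_0 algebra_simps)
  show "scal (c + d) u = scal c u + scal d u"
    by transfer (simp add: rel_cong_def relation_ideal_0 free_const_def single_add algebra_simps)
  show "scal c (scal d u) = scal (c * d) u"
    by transfer
       (simp add: rel_cong_def relation_ideal_0 free_const_def mult.assoc[symmetric] mult_single)
  show "scal 1 u = u"
    by transfer (simp add: rel_cong_def relation_ideal_0 free_const_def)
qed

lemma scal_mult_left: "scal c u * v = scal c (u * v)"
  by transfer (simp add: rel_cong_def relation_ideal_0 mult.assoc)

lemma free_const_commute: "free_const c * p = p * free_const c"
proof (induction p rule: free_alg_induct)
  case zero
  show ?case by simp
next
  case (add_single p v d)
  then show ?case
    by (simp add: distrib_left distrib_right free_const_def mult_single mult.commute)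
qed

lemma scal_mult_right: "u * scal c v = scal c (u * v)"
proof transfer
  fix u v :: "'a free_alg" and c :: 'a
  have "u * (free_const c * v) = free_const c * (u * v)"
    by (simp only: mult.assoc[symmetric] free_const_commute[of c u])
  then show "rel_cong (u * (free_const c * v)) (free_const c * (u * v))"
    by (simp add: rel_cong_def relation_ideal_0)
qed

lemma algA_relations:
  "gen_a ^ 2 = (1 :: 'k::field algA)" "gen_b ^ 6 = (1 :: 'k algA)" "gen_x ^ 2 = (0 :: 'k algA)"
  "gen_a * gen_b = (gen_b * gen_a :: 'k algA)" "gen_a * gen_x = (gen_x * gen_a :: 'k algA)"
  "gen_b * gen_x = - (gen_x * gen_b :: 'k algA)"
proof -
  have *: "r \<in> relation_ideal" if "r \<in> relators" for r :: "'k free_alg"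
    using that relators_subset_relation_ideal by blast
  show "gen_a ^ 2 = (1 :: 'k algA)"
    unfolding power2_eq_square
    by transfer
       (unfold rel_cong_def, rule *, simp add: relators_def Let_def power2_eq_square)
  show "gen_x ^ 2 = (0 :: 'k algA)"
    unfolding power2_eq_square
    by transfer
       (unfold rel_cong_def, rule *, simp add: relators_def Let_def power2_eq_square)
  have "gen_b * (gen_b * (gen_b * (gen_b * (gen_b * gen_b)))) = (1 :: 'k algA)"
    by transfer
       (unfold rel_cong_def, rule *, simp add: relators_def Let_def eval_nat_numeral mult.assoc)
  then show "gen_b ^ 6 = (1 :: 'k algA)" by (simp add: eval_nat_numeral mult.assoc)
  show "gen_a * gen_b = (gen_b * gen_a :: 'k algA)"
    by transfer (unfold rel_cong_def, rule *, simp add: relators_def Let_def)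
  show "gen_a * gen_x = (gen_x * gen_a :: 'k algA)"
    by transfer (unfold rel_cong_def, rule *, simp add: relators_def Let_def)
  show "gen_b * gen_x = - (gen_x * gen_b :: 'k algA)"
    by transfer (unfold rel_cong_def, rule *, simp add: relators_def Let_def)
qed

subsection \<open>Right ideals as right modules\<close>

definition right_ideal :: "'a::ring_1 set \<Rightarrow> bool"
  where "right_ideal I \<longleftrightarrow>
    0 \<in> I \<and> (\<forall>u\<in>I. \<forall>v\<in>I. u + v \<in> I) \<and> (\<forall>u\<in>I. \<forall>r. u * r \<in> I)"

definition right_module_iso :: "'a::ring_1 set \<Rightarrow> 'a set \<Rightarrow> bool"
  where "right_module_iso I J \<longleftrightarrow>
    (\<exists>\<phi>. bij_betw \<phi> I J \<and> (\<forall>u\<in>I. \<forall>v\<in>I. \<phi> (u + v) = \<phi> u + \<phi> v) \<and>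
         (\<forall>u\<in>I. \<forall>r. \<phi> (u * r) = \<phi> u * r))"

text \<open>
  The submodules of a right ideal \<open>I\<close> are the right ideals contained in \<open>I\<close>; the
  inclusions \<open>J, K \<subseteq> I\<close> follow from \<open>J + K = I\<close>.
\<close>

definition indecomposable_right_ideal :: "'a::ring_1 set \<Rightarrow> bool"
  where "indecomposable_right_ideal I \<longleftrightarrow>
    right_ideal I \<and> I \<noteq> {0} \<and>
    (\<forall>J K. right_ideal J \<and> right_ideal K \<and> {u + v | u v. u \<in> J \<and> v \<in> K} = I \<and> J \<inter> K = {0}
       \<longrightarrow> J = {0} \<or> K = {0})"

definition L_in :: "'a::ring_1 set set"
  where "L_in = {I. indecomposable_right_ideal I}"

subsection \<open>Idempotents and the right ideals \<open>N\<^sub>s\<^sub>,\<^sub>t\<^sub>,\<^sub>m\<close>\<close>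

definition primitive_root_of_unity :: "nat \<Rightarrow> 'k::field \<Rightarrow> bool"
  where "primitive_root_of_unity n z \<longleftrightarrow> n > 0 \<and> z ^ n = 1 \<and> (\<forall>k. 0 < k \<and> k < n \<longrightarrow> z ^ k \<noteq> 1)"

definition subalgebra :: "'k::field algA set \<Rightarrow> bool"
  where "subalgebra S \<longleftrightarrow> algA.subspace S \<and> 1 \<in> S \<and> (\<forall>u\<in>S. \<forall>v\<in>S. u * v \<in> S)"

definition subalg_R :: "'k::field algA set"
  where "subalg_R = subalgebra hull {gen_x}"

text \<open>Only the indices \<open>0\<close> and \<open>1\<close> are meaningful here.\<close>

definition idem_e :: "nat \<Rightarrow> 'k::field algA"
  where "idem_e i = scal (1 / 2) (if i = 0 then 1 + gen_a else 1 - gen_a)"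

definition idem_f :: "'k::field \<Rightarrow> int \<Rightarrow> 'k algA"
  where "idem_f \<zeta> j = scal (1 / 6) (\<Sum>i=0..5. scal (\<zeta> powi (j * int i)) (gen_b ^ i))"

definition idem :: "'k::field \<Rightarrow> nat \<Rightarrow> int \<Rightarrow> 'k algA"
  where "idem \<zeta> i j = idem_e i * idem_f \<zeta> j"

definition N_ideal :: "'k::field \<Rightarrow> nat \<Rightarrow> int \<Rightarrow> nat \<Rightarrow> 'k algA set"
  where "N_ideal \<zeta> s t m = (\<lambda>r. idem \<zeta> s t * gen_x ^ m * r) ` subalg_R"

end

theory Submission
  imports Defs
begin

text \<open>
  The algebra \<open>A\<close> is the sum of the right ideals \<open>e A\<close> for the twelve orthogonal
  idempotents \<open>e = e\<^sub>s\<^sub>,\<^sub>t\<close>, each of which is a left and right eigenvector of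
  \<open>a\<close> and of \<open>b\<close>. Multiplication by \<open>x\<close> permutes them: since \<open>\<zeta>\<^sup>3 = - 1\<close> and
  \<open>b x = - x b\<close>, one has \<open>x e\<^sub>s\<^sub>,\<^sub>t = e\<^sub>s\<^sub>,\<^sub>t\<^sub>+\<^sub>3 x\<close>. Hence \<open>e A\<close> is spanned by
  \<open>e\<close> and \<open>e x\<close>, and \<open>A e\<close> is spanned by \<open>e\<close> and \<open>x e\<close>. That these spans
  are two-dimensional rests on \<open>e x \<noteq> 0\<close> (\<open>idem_gen_x_neq_0\<close>), which is read off from
  a two-dimensional representation of \<open>A\<close>.

  The module \<open>e A\<close> is uniserial, because an element not killed by \<open>x\<close> generates all of
  it, and \<open>e x A\<close> is simple; so all \<open>N\<^sub>s\<^sub>,\<^sub>t\<^sub>,\<^sub>m\<close> are indecomposable. They are pairwise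
  non-isomorphic (\<open>N_iso_imp_eq\<close>): \<open>m\<close> is determined by whether \<open>x\<close> annihilates the
  module \<open>M\<close>, and \<open>(s, t)\<close> by the eigenvalues of \<open>a\<close> and \<open>b\<close> on the
  one-dimensional quotient \<open>M / M x\<close>.

  The classification uses one principle, \<open>indecomposable_idempotent_endomorphism\<close>: an
  idempotent endomorphism of an indecomposable module is \<open>0\<close> or the identity. Let \<open>I\<close>
  be an indecomposable right ideal.

  If \<open>I x = 0\<close>, then \<open>u \<mapsto> u e\<close> is a module endomorphism of \<open>I\<close> for each
  idempotent \<open>e\<close>. As the idempotents add up to \<open>1\<close>, it is non-zero for some \<open>e\<close>, hence the identity, and \<open>I = I e\<close> lies
  in the part of \<open>A e\<close> killed by \<open>x\<close>, the line spanned by \<open>x e = e' x\<close> with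
  \<open>e'\<close> another of the idempotents. So \<open>I = e' x R\<close>.

  If \<open>I x \<noteq> 0\<close>, some \<open>v \<in> I\<close> of the form \<open>v = \<alpha> e + \<beta> x e\<close> has
  \<open>\<alpha> \<noteq> 0\<close>. After scaling, \<open>v = g e\<close> with the unit \<open>g = 1 + \<gamma> x\<close>. The right
  ideal \<open>v A\<close> is generated by the idempotent \<open>g e g\<^sup>-\<^sup>1\<close>, and left multiplication by it
  maps \<open>I\<close> into \<open>v A \<subseteq> I\<close> and fixes \<open>v\<close>; so it is the identity of
  \<open>I\<close>, and \<open>I = g e A\<close>.
\<close>

section \<open>Right ideals of a ring\<close>

lemma right_ideal_0: "right_ideal I \<Longrightarrow> 0 \<in> I"
  and right_ideal_add: "right_ideal I \<Longrightarrow> u \<in> I \<Longrightarrow> v \<in> I \<Longrightarrow> u + v \<in> I"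
  and right_ideal_mult: "right_ideal I \<Longrightarrow> u \<in> I \<Longrightarrow> u * r \<in> I"
  by (auto simp: right_ideal_def)

lemma right_ideal_diff: "right_ideal I \<Longrightarrow> u \<in> I \<Longrightarrow> v \<in> I \<Longrightarrow> u - v \<in> I"
  using right_ideal_add[of I u "v * (- 1)"] right_ideal_mult[of I v "- 1"] by simp

lemma right_ideal_scal:
  fixes I :: "'k::field algA set"
  shows "right_ideal I \<Longrightarrow> u \<in> I \<Longrightarrow> scal c u \<in> I"
  using right_ideal_mult[of I u "scal c 1"] by (simp add: scal_mult_right)

lemma right_ideal_sum_superset:
  assumes J: "right_ideal J" and K: "right_ideal K" and sum: "{u + v |u v. u \<in> J \<and> v \<in> K} = I"
  shows "J \<subseteq> I" "K \<subseteq> I"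
proof -
  have "u + v \<in> I" if "u \<in> J" "v \<in> K" for u v using that sum by blast
  from this[OF _ right_ideal_0[OF K]] this[OF right_ideal_0[OF J]]
  show "J \<subseteq> I" "K \<subseteq> I" by auto
qed

text \<open>
  If \<open>\<phi>\<close> were neither \<open>0\<close> nor the identity, the image and the kernel of \<open>\<phi>\<close> would be a proper decomposition of \<open>I\<close>.
  Stating this for endomorphisms covers both right multiplication by an idempotent that commutes
  with the action and left multiplication by an idempotent that preserves \<open>I\<close>.
\<close>

lemma indecomposable_idempotent_endomorphism:
  assumes ind: "indecomposable_right_ideal I"
    and into: "\<And>u. u \<in> I \<Longrightarrow> \<phi> u \<in> I"
    and add: "\<And>u v. u \<in> I \<Longrightarrow> v \<in> I \<Longrightarrow> \<phi> (u + v) = \<phi> u + \<phi> v"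
    and mult: "\<And>u r. u \<in> I \<Longrightarrow> \<phi> (u * r) = \<phi> u * r"
    and idem: "\<And>u. u \<in> I \<Longrightarrow> \<phi> (\<phi> u) = \<phi> u"
    and v: "v \<in> I" "\<phi> v \<noteq> 0" and u: "u \<in> I"
  shows "\<phi> u = u"
proof -
  let ?J = "{w \<in> I. \<phi> w = w}" and ?K = "{w \<in> I. \<phi> w = 0}"
  have I: "right_ideal I" using ind by (simp add: indecomposable_right_ideal_def)
  have zero: "\<phi> 0 = 0" using add[of 0 0] right_ideal_0[OF I] by simp
  have J: "right_ideal ?J" and K: "right_ideal ?K"
    using I zero add mult by (auto simp: right_ideal_def)
  have diff: "w - \<phi> w \<in> ?K" if "w \<in> I" for w
  proof -
    have "w - \<phi> w \<in> I" using I that into by (simp add: right_ideal_diff)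
    moreover from this have "\<phi> w = \<phi> (w - \<phi> w) + \<phi> w"
      using add[of "w - \<phi> w" "\<phi> w"] idem[of w] into[of w] that by simp
    ultimately show ?thesis by simp
  qed
  have "{a + b |a b. a \<in> ?J \<and> b \<in> ?K} = I"
  proof
    show "{a + b |a b. a \<in> ?J \<and> b \<in> ?K} \<subseteq> I" using right_ideal_add[OF I] by auto
    show "I \<subseteq> {a + b |a b. a \<in> ?J \<and> b \<in> ?K}"
    proof
      fix w assume w: "w \<in> I"
      have "w = \<phi> w + (w - \<phi> w)" by simp
      then show "w \<in> {a + b |a b. a \<in> ?J \<and> b \<in> ?K}"
        using diff[OF w] into[OF w] idem[OF w] by blast
    qed
  qed
  moreover have "?J \<inter> ?K = {0}" using zero right_ideal_0[OF I] by auto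
  ultimately have "?J = {0} \<or> ?K = {0}"
    using ind J K unfolding indecomposable_right_ideal_def by blast
  moreover have "\<phi> v \<in> ?J" using v into idem by simp
  ultimately have "?K = {0}" using v(2) by blast
  with diff[OF u] show ?thesis by (metis singletonD eq_iff_diff_eq_0)
qed

lemma right_ideal_left_mult:
  assumes "right_ideal I"
  shows "right_ideal ((*) g ` I)"
  unfolding right_ideal_def
proof (intro conjI ballI allI)
  show "0 \<in> (*) g ` I" using right_ideal_0[OF assms] by (metis image_eqI mult_zero_right)
  show "u + v \<in> (*) g ` I" if uv: "u \<in> (*) g ` I" "v \<in> (*) g ` I" for u v
  proof -
    obtain w z where "w \<in> I" "z \<in> I" "u = g * w" "v = g * z" using uv by blast
    then show ?thesis using right_ideal_add[OF assms] by (simp flip: distrib_left)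
  qed
  show "u * r \<in> (*) g ` I" if u: "u \<in> (*) g ` I" for u r
  proof -
    obtain w where "w \<in> I" "u = g * w" using u by blast
    then show ?thesis using right_ideal_mult[OF assms] by (simp add: mult.assoc)
  qed
qed

text \<open>
  Left multiplication by \<open>h = g\<^sup>-\<^sup>1\<close> carries a decomposition of \<open>g I\<close> back to one of
  \<open>I\<close>.
\<close>

lemma indecomposable_left_unit_mult:
  fixes g h :: "'a::ring_1"
  assumes ind: "indecomposable_right_ideal I" and hg: "h * g = 1" and gh: "g * h = 1"
  shows "indecomposable_right_ideal ((*) g ` I)"
proof -
  have hgu: "h * (g * u) = u" and ghu: "g * (h * u) = u" for u
    using hg gh by (simp_all add: mult.assoc[symmetric])
  have I: "right_ideal I" "I \<noteq> {0}"
    and dec: "\<And>J K. right_ideal J \<Longrightarrow> right_ideal K \<Longrightarrow> {u + v |u v. u \<in> J \<and> v \<in> K} = I \<Longrightarrow>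
      J \<inter> K = {0} \<Longrightarrow> J = {0} \<or> K = {0}"
    using ind by (auto simp: indecomposable_right_ideal_def)
  have gh_image: "J = (*) g ` (*) h ` J" and hg_image: "J = (*) h ` (*) g ` J" for J
    by (simp_all add: image_image ghu hgu)
  have inter: "(*) h ` J \<inter> (*) h ` K = (*) h ` (J \<inter> K)" for J K
    by (rule image_Int[symmetric]) (metis ghu injI)
  show ?thesis
    unfolding indecomposable_right_ideal_def
  proof (intro conjI allI impI)
    show "right_ideal ((*) g ` I)" by (rule right_ideal_left_mult[OF I(1)])
    show "(*) g ` I \<noteq> {0}"
      using I(2) hg_image[of I] by auto
    fix J K
    assume JK: "right_ideal J \<and> right_ideal K \<and> {u + v |u v. u \<in> J \<and> v \<in> K} = (*) g ` I \<and>
      J \<inter> K = {0}"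
    have "{u + v |u v. u \<in> (*) h ` J \<and> v \<in> (*) h ` K} = (*) h ` {u + v |u v. u \<in> J \<and> v \<in> K}"
      by (auto simp: image_iff) (metis distrib_left)+
    also have "\<dots> = I" using JK hg_image[of I] by simp
    finally have "(*) h ` J = {0} \<or> (*) h ` K = {0}"
      using JK by (intro dec) (simp_all add: right_ideal_left_mult inter)
    then show "J = {0} \<or> K = {0}"
      using gh_image[of J] gh_image[of K] by auto
  qed
qed

lemma right_module_iso_sym:
  assumes "right_ideal I" "right_module_iso I J"
  shows "right_module_iso J I"
proof -
  obtain \<phi> where bij: "bij_betw \<phi> I J"
    and add: "\<And>u v. u \<in> I \<Longrightarrow> v \<in> I \<Longrightarrow> \<phi> (u + v) = \<phi> u + \<phi> v"
    and mult: "\<And>u r. u \<in> I \<Longrightarrow> \<phi> (u * r) = \<phi> u * r"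
    using assms(2) unfolding right_module_iso_def by blast
  let ?\<psi> = "the_inv_into I \<phi>"
  have inj: "inj_on \<phi> I" and surj: "\<phi> ` I = J" using bij by (auto simp: bij_betw_def)
  have inv: "?\<psi> (\<phi> u) = u" if "u \<in> I" for u using the_inv_into_f_f[OF inj that] .
  have "?\<psi> (u + v) = ?\<psi> u + ?\<psi> v" if uv: "u \<in> J" "v \<in> J" for u v
  proof -
    obtain w z where "w \<in> I" "z \<in> I" "u = \<phi> w" "v = \<phi> z" using uv surj by blast
    then show ?thesis
      using inv[of w] inv[of z] inv[of "w + z"] add[of w z] right_ideal_add[OF assms(1)] by simp
  qed
  moreover have "?\<psi> (u * r) = ?\<psi> u * r" if u: "u \<in> J" for u r
  proof -
    obtain w where "w \<in> I" "u = \<phi> w" using u surj by blast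
    then show ?thesis
      using inv[of w] inv[of "w * r"] mult[of w r] right_ideal_mult[OF assms(1)] by simp
  qed
  ultimately show ?thesis
    using bij_betw_the_inv_into[OF bij] unfolding right_module_iso_def
    by (intro exI[of _ ?\<psi>]) simp
qed

lemma right_module_iso_trans:
  assumes "right_module_iso I J" "right_module_iso J K"
  shows "right_module_iso I K"
proof -
  obtain \<phi> where \<phi>: "bij_betw \<phi> I J"
      "\<forall>u\<in>I. \<forall>v\<in>I. \<phi> (u + v) = \<phi> u + \<phi> v" "\<forall>u\<in>I. \<forall>r. \<phi> (u * r) = \<phi> u * r"
    using assms(1) unfolding right_module_iso_def by blast
  obtain \<psi> where \<psi>: "bij_betw \<psi> J K"
      "\<forall>u\<in>J. \<forall>v\<in>J. \<psi> (u + v) = \<psi> u + \<psi> v" "\<forall>u\<in>J. \<forall>r. \<psi> (u * r) = \<psi> u * r"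
    using assms(2) unfolding right_module_iso_def by blast
  have "\<phi> u \<in> J" if "u \<in> I" for u using that \<phi>(1) by (auto simp: bij_betw_def)
  then show ?thesis
    using \<phi> \<psi> bij_betw_trans[OF \<phi>(1) \<psi>(1)]
    unfolding right_module_iso_def by (intro exI[of _ "\<psi> \<circ> \<phi>"]) simp
qed

lemma right_module_iso_left_mult:
  fixes g h :: "'a::ring_1"
  assumes "h * g = 1"
  shows "right_module_iso I ((*) g ` I)"
proof -
  have "inj_on ((*) g) I"
    using assms by (intro inj_on_inverseI[of _ "(*) h"]) (simp add: mult.assoc[symmetric])
  then show ?thesis
    unfolding right_module_iso_def
    by (intro exI[of _ "(*) g"]) (simp add: bij_betw_def distrib_left mult.assoc)
qed

section \<open>The generators and their relations\<close>

text \<open>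
  The induction principle for \<open>A\<close>: a property that is stable under the algebra operations
  need only be checked on \<open>a\<close>, \<open>b\<close> and \<open>x\<close>.
\<close>

lemma subalgebra_containing_generators:
  fixes S :: "'k::field algA set"
  assumes S: "subalgebra S" and gens: "gen_a \<in> S" "gen_b \<in> S" "gen_x \<in> S"
  shows "u \<in> S"
proof (induction u rule: algA.abs_induct)
  case (1 p)
  have sub: "algA.subspace S" using S by (simp add: subalgebra_def)
  have gen: "abs_algA (free_gen g) \<in> S" for g
    using gens by (cases g) (simp_all add: gen_a.abs_eq gen_b.abs_eq gen_x.abs_eq)
  have word: "abs_algA (Poly_Mapping.single (Word l) 1) \<in> S" for l
  proof (induction l)
    case Nil
    have "abs_algA (Poly_Mapping.single (Word []) 1) = (1 :: 'k algA)"
      by (simp add: zero_word_def[symmetric] one_algA_def)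
    then show ?case using S by (simp add: subalgebra_def)
  next
    case (Cons g l)
    have "abs_algA (Poly_Mapping.single (Word (g # l)) 1) =
        abs_algA (free_gen g) * abs_algA (Poly_Mapping.single (Word l) (1::'k))"
      by (simp add: times_algA.abs_eq free_gen_def mult_single plus_word_def)
    then show ?case using S Cons gen by (simp add: subalgebra_def)
  qed
  show ?case
  proof (induction p rule: free_alg_induct)
    case zero
    then show ?case using algA.subspace_0[OF sub] by (simp add: zero_algA_def)
  next
    case (add_single p w c)
    have "abs_algA (p + Poly_Mapping.single w c) =
        abs_algA p + scal c (abs_algA (Poly_Mapping.single w 1))"
      by (simp add: plus_algA.abs_eq scal.abs_eq free_const_def mult_single)
    then show ?case
      using algA.subspace_add[OF sub add_single] algA.subspace_scale[OF sub] word
      by (metis word.collapse)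
  qed
qed

text \<open>
  The elements that map a given subspace into itself form a subalgebra, so only the generators
  matter.
\<close>

lemma right_ideal_if_subspace:
  fixes N :: "'k::field algA set"
  assumes N: "algA.subspace N"
    and gens: "\<And>u. u \<in> N \<Longrightarrow> u * gen_a \<in> N" "\<And>u. u \<in> N \<Longrightarrow> u * gen_b \<in> N"
      "\<And>u. u \<in> N \<Longrightarrow> u * gen_x \<in> N"
  shows "right_ideal N"
proof -
  have "subalgebra {r. \<forall>u\<in>N. u * r \<in> N}"
    using N unfolding subalgebra_def algA.subspace_def
    by (simp add: distrib_left scal_mult_right flip: mult.assoc)
  then have "r \<in> {r. \<forall>u\<in>N. u * r \<in> N}" for r
    by (rule subalgebra_containing_generators) (use gens in simp_all)
  then show ?thesis using N by (auto simp: right_ideal_def algA.subspace_def)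
qed

lemma left_mult_closed_if_subspace:
  fixes N :: "'k::field algA set"
  assumes N: "algA.subspace N"
    and gens: "\<And>u. u \<in> N \<Longrightarrow> gen_a * u \<in> N" "\<And>u. u \<in> N \<Longrightarrow> gen_b * u \<in> N"
      "\<And>u. u \<in> N \<Longrightarrow> gen_x * u \<in> N"
    and u: "u \<in> N"
  shows "r * u \<in> N"
proof -
  have "subalgebra {r. \<forall>u\<in>N. r * u \<in> N}"
    using N unfolding subalgebra_def algA.subspace_def
    by (simp add: distrib_right scal_mult_left mult.assoc)
  then have "r \<in> {r. \<forall>u\<in>N. r * u \<in> N}"
    by (rule subalgebra_containing_generators) (use gens in simp_all)
  then show ?thesis using u by simp
qed

lemma subspace_span_pair:
  "algA.subspace {scal \<alpha> u + scal \<beta> v |\<alpha> \<beta>. True}"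
  unfolding algA.subspace_def
proof (intro conjI ballI allI)
  show "0 \<in> {scal \<alpha> u + scal \<beta> v |\<alpha> \<beta>. True}"
    by (intro CollectI exI[of _ 0]) simp
next
  fix y z assume "y \<in> {scal \<alpha> u + scal \<beta> v |\<alpha> \<beta>. True}" "z \<in> {scal \<alpha> u + scal \<beta> v |\<alpha> \<beta>. True}"
  then obtain \<alpha> \<beta> \<gamma> \<delta> where "y = scal \<alpha> u + scal \<beta> v" "z = scal \<gamma> u + scal \<delta> v" by blast
  then have "y + z = scal (\<alpha> + \<gamma>) u + scal (\<beta> + \<delta>) v" by (simp add: algA.scale_left_distrib)
  then show "y + z \<in> {scal \<alpha> u + scal \<beta> v |\<alpha> \<beta>. True}" by blast
next
  fix c y assume "y \<in> {scal \<alpha> u + scal \<beta> v |\<alpha> \<beta>. True}"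
  then obtain \<alpha> \<beta> where "y = scal \<alpha> u + scal \<beta> v" by blast
  then have "scal c y = scal (c * \<alpha>) u + scal (c * \<beta>) v" by (simp add: algA.scale_right_distrib)
  then show "scal c y \<in> {scal \<alpha> u + scal \<beta> v |\<alpha> \<beta>. True}" by blast
qed

lemma gen_a_gen_a: "gen_a * gen_a = (1 :: 'k::field algA)"
  using algA_relations(1) by (simp add: power2_eq_square)

lemma gen_x_gen_x: "gen_x * gen_x = (0 :: 'k::field algA)"
  using algA_relations(3) by (simp add: power2_eq_square)

lemma gen_x_gen_x_left: "gen_x * (gen_x * u) = (0 :: 'k::field algA)"
  by (simp add: mult.assoc[symmetric] gen_x_gen_x)

lemma mem_subalg_R_iff: "r \<in> subalg_R \<longleftrightarrow> (\<exists>\<alpha> \<beta>. r = scal \<alpha> 1 + scal \<beta> gen_x)"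
proof -
  let ?S = "{scal \<alpha> 1 + scal \<beta> gen_x |\<alpha> \<beta>. True} :: 'a algA set"
  have "subalg_R = ?S"
    unfolding subalg_R_def
  proof (rule hull_unique)
    show "{gen_x} \<subseteq> ?S" by (simp, rule exI[of _ 0], rule exI[of _ 1]) simp
    have "u * v \<in> ?S" if uv: "u \<in> ?S" "v \<in> ?S" for u v
    proof -
      obtain \<alpha> \<beta> \<gamma> \<delta> where "u = scal \<alpha> 1 + scal \<beta> gen_x" "v = scal \<gamma> 1 + scal \<delta> gen_x"
        using uv by blast
      then have "u * v = scal (\<alpha> * \<gamma>) 1 + scal (\<alpha> * \<delta> + \<beta> * \<gamma>) gen_x"
        by (simp add: algebra_simps scal_mult_left scal_mult_right algA.scale_left_distrib
            algA.scale_right_distrib gen_x_gen_x)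
      then show ?thesis by blast
    qed
    moreover have "1 \<in> ?S" by (rule CollectI, rule exI[of _ 1], rule exI[of _ 0]) simp
    ultimately show "subalgebra ?S"
      unfolding subalgebra_def using subspace_span_pair by blast
    show "?S \<subseteq> T" if T: "{gen_x} \<subseteq> T" "subalgebra T" for T
    proof -
      have "algA.subspace T" "1 \<in> T" "gen_x \<in> T" using T by (simp_all add: subalgebra_def)
      then have "scal \<alpha> 1 + scal \<beta> gen_x \<in> T" for \<alpha> \<beta>
        by (simp add: algA.subspace_add algA.subspace_scale)
      then show ?thesis by blast
    qed
  qed
  then show ?thesis by blast
qed

section \<open>A matrix coefficient of a two-dimensional representation\<close>

text \<open>
  A presentation by generators and relations does not show that anything in \<open>A\<close> is non-zero.
  For \<open>\<sigma>\<^sup>2 = \<beta>\<^sup>6 = 1\<close> the operators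
  \<open>a \<mapsto> diag (\<sigma>, \<sigma>)\<close>, \<open>b \<mapsto> diag (\<beta>, - \<beta>)\<close>, \<open>x \<mapsto> E\<^sub>1\<^sub>2\<close>
  on \<open>k \<times> k\<close> satisfy the relations. The upper right matrix entry is a function on
  words with value \<open>1\<close> at \<open>x\<close>. Its linear extension to the free algebra vanishes on the
  ideal of relations, which gives a linear form on \<open>A\<close>.
\<close>

primrec gen_action :: "'k::field \<Rightarrow> 'k \<Rightarrow> generator \<Rightarrow> 'k \<times> 'k \<Rightarrow> 'k \<times> 'k" where
  "gen_action \<sigma> \<beta> GenA = (\<lambda>(y, z). (\<sigma> * y, \<sigma> * z))"
| "gen_action \<sigma> \<beta> GenB = (\<lambda>(y, z). (\<beta> * y, - (\<beta> * z)))"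
| "gen_action \<sigma> \<beta> GenX = (\<lambda>(y, z). (z, 0))"

definition word_entry :: "'k::field \<Rightarrow> 'k \<Rightarrow> word \<Rightarrow> 'k"
  where "word_entry \<sigma> \<beta> w = fst (foldr (gen_action \<sigma> \<beta>) (letters w) (0, 1))"

definition free_entry :: "'k::field \<Rightarrow> 'k \<Rightarrow> 'k free_alg \<Rightarrow> 'k"
  where "free_entry \<sigma> \<beta> p =
    (\<Sum>w\<in>Poly_Mapping.keys p. Poly_Mapping.lookup p w * word_entry \<sigma> \<beta> w)"

lemma free_entry_superset:
  assumes "finite S" "Poly_Mapping.keys p \<subseteq> S"
  shows "free_entry \<sigma> \<beta> p = (\<Sum>w\<in>S. Poly_Mapping.lookup p w * word_entry \<sigma> \<beta> w)"
  unfolding free_entry_def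
  by (rule sum.mono_neutral_left) (use assms in \<open>auto simp: in_keys_iff\<close>)

lemma free_entry_single: "free_entry \<sigma> \<beta> (Poly_Mapping.single w c) = c * word_entry \<sigma> \<beta> w"
  by (subst free_entry_superset[of "{w}"]) auto

lemma free_entry_0: "free_entry \<sigma> \<beta> 0 = 0"
  by (simp add: free_entry_def)

lemma free_entry_add: "free_entry \<sigma> \<beta> (p + q) = free_entry \<sigma> \<beta> p + free_entry \<sigma> \<beta> q"
proof -
  let ?S = "Poly_Mapping.keys p \<union> Poly_Mapping.keys q"
  have "Poly_Mapping.keys (p + q) \<subseteq> ?S" by (rule Poly_Mapping.keys_add)
  then show ?thesis
    by (subst (1 2 3) free_entry_superset[of ?S])
       (auto simp: lookup_add algebra_simps sum.distrib)
qed

lemma free_entry_diff: "free_entry \<sigma> \<beta> (p - q) = free_entry \<sigma> \<beta> p - free_entry \<sigma> \<beta> q"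
  using free_entry_add[of \<sigma> \<beta> "p - q" q] by simp

lemma free_entry_mult_single:
  assumes "\<And>v. word_entry \<sigma> \<beta> (w + v) = d * word_entry \<sigma> \<beta> v"
  shows "free_entry \<sigma> \<beta> (Poly_Mapping.single w c * p) = c * d * free_entry \<sigma> \<beta> p"
proof (induction p rule: free_alg_induct)
  case (add_single p v e)
  then show ?case
    by (simp add: distrib_left free_entry_add mult_single free_entry_single assms algebra_simps)
qed (simp add: free_entry_0)

lemma gen_actions_scale:
  "foldr (gen_action \<sigma> \<beta>) l (d * y, d * z) = map_prod ((*) d) ((*) d) (foldr (gen_action \<sigma> \<beta>) l (y, z))"
proof (induction l)
  case (Cons g l)
  then show ?case
    by (cases g; cases "foldr (gen_action \<sigma> \<beta>) l (y, z)") simp_all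
qed simp

text \<open>
  The relators are all of the form \<open>m - d n\<close> with words \<open>m\<close>, \<open>n\<close> and a scalar
  \<open>d\<close>, with \<open>d = 0\<close> for \<open>x\<^sup>2\<close> and \<open>d = - 1\<close> for \<open>b x + x b\<close>. If \<open>m\<close> and
  \<open>d n\<close> act in the same way, then they do so between any two further factors.
\<close>

lemma free_entry_relator:
  assumes rel: "\<And>y z. foldr (gen_action \<sigma> \<beta>) m (y, z) =
      map_prod ((*) d) ((*) d) (foldr (gen_action \<sigma> \<beta>) n (y, z))"
  shows "free_entry \<sigma> \<beta> (p * (Poly_Mapping.single (Word m) 1 - Poly_Mapping.single (Word n) d) * q) = 0"
proof (induction p rule: free_alg_induct)
  case (add_single p w c)
  let ?r = "Poly_Mapping.single (Word m) 1 - Poly_Mapping.single (Word n) d"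
  have "free_entry \<sigma> \<beta> (Poly_Mapping.single w c * ?r * q) = 0"
  proof (induction q rule: free_alg_induct)
    case (add_single q v e)
    have "foldr (gen_action \<sigma> \<beta>) l (foldr (gen_action \<sigma> \<beta>) m y) =
       map_prod ((*) d) ((*) d) (foldr (gen_action \<sigma> \<beta>) l (foldr (gen_action \<sigma> \<beta>) n y))" for l y
      by (cases y, cases "foldr (gen_action \<sigma> \<beta>) n y") (simp add: rel gen_actions_scale)
    then have "word_entry \<sigma> \<beta> (w + Word m + v) = d * word_entry \<sigma> \<beta> (w + Word n + v)"
      by (simp add: word_entry_def plus_word_def)
    then show ?case using add_single
      by (simp add: distrib_left right_diff_distrib left_diff_distrib free_entry_add free_entry_diff
          mult_single free_entry_single)
  qed (simp add: free_entry_0)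
  then show ?case using add_single by (simp add: distrib_right free_entry_add)
qed (simp add: free_entry_0)

text \<open>
  The form \<open>free_entry\<close> is not multiplicative, so its kernel is no ideal; but the elements
  \<open>p\<close> such that it vanishes on all \<open>l p r\<close> form a two-sided ideal, and this contains the
  relators.
\<close>

lemma free_entry_relation_ideal:
  assumes \<sigma>: "\<sigma> ^ 2 = 1" and \<beta>: "\<beta> ^ 6 = 1" and p: "p \<in> relation_ideal"
  shows "free_entry \<sigma> \<beta> p = 0"
proof -
  let ?I = "{p. \<forall>l r. free_entry \<sigma> \<beta> (l * p * r) = 0}"
  let ?S = "\<lambda>l c. Poly_Mapping.single (Word l) (c :: 'a)"
  have "two_sided_ideal ?I"
    unfolding two_sided_ideal_def
    by (auto simp: free_entry_0 free_entry_add distrib_left distrib_right)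
      (metis mult.assoc)+
  moreover have "p \<in> ?I" if p: "p \<in> relators" for p
  proof -
    have pow: "free_gen g ^ n = ?S (replicate n g) 1" for g n
      by (induction n) (simp_all add: free_gen_def mult_single plus_word_def zero_word_def[symmetric])
    have one: "1 = ?S [] 1" by (simp add: zero_word_def[symmetric])
    let ?T = "{?S [GenA, GenA] 1 - ?S [] 1, ?S [GenB, GenB, GenB, GenB, GenB, GenB] 1 - ?S [] 1,
        ?S [GenX, GenX] 1 - ?S [] 0, ?S [GenA, GenB] 1 - ?S [GenB, GenA] 1,
        ?S [GenA, GenX] 1 - ?S [GenX, GenA] 1, ?S [GenB, GenX] 1 - ?S [GenX, GenB] (- 1)}"
    have "p \<in> ?T"
      using p unfolding relators_def Let_def pow one
      by (simp add: free_gen_def mult_single plus_word_def eval_nat_numeral single_uminus)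
    moreover have "\<beta> * (\<beta> * (\<beta> * (\<beta> * (\<beta> * (\<beta> * y))))) = y" for y
      using \<beta> by (simp add: eval_nat_numeral flip: mult.assoc)
    moreover have "\<sigma> * (\<sigma> * y) = y" for y
      using \<sigma> by (simp add: power2_eq_square flip: mult.assoc)
    ultimately show ?thesis
    proof -
      assume "p \<in> ?T" and [simp]: "\<And>y. \<beta> * (\<beta> * (\<beta> * (\<beta> * (\<beta> * (\<beta> * y))))) = y"
        "\<And>y. \<sigma> * (\<sigma> * y) = y"
      have "?T \<subseteq> ?I"
        unfolding insert_subset
        by (intro conjI CollectI allI free_entry_relator empty_subsetI) simp_all
      then show ?thesis using \<open>p \<in> ?T\<close> by (rule subsetD)
    qed
  qed
  ultimately have "relation_ideal \<subseteq> ?I"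
    unfolding relation_ideal_def by (intro hull_minimal subsetI)
  then have "p \<in> ?I" using p by (rule subsetD)
  then have "free_entry \<sigma> \<beta> (1 * p * 1) = 0" by (elim CollectE allE)
  then show ?thesis by simp
qed

text \<open>
  As \<open>a\<close> and \<open>b\<close> act diagonally, the first row of a product \<open>a u\<close> or \<open>b u\<close> is a
  multiple of the first row of \<open>u\<close>. These rules and the value at \<open>x\<close> determine the form
  on all products of idempotents with \<open>x\<close>.
\<close>

lemma matrix_coefficient_exists:
  fixes \<sigma> \<beta> :: "'k::field"
  assumes "\<sigma> ^ 2 = 1" "\<beta> ^ 6 = 1"
  obtains c :: "'k algA \<Rightarrow> 'k" where
    "\<And>u v. c (u + v) = c u + c v" "\<And>d u. c (scal d u) = d * c u"
    "\<And>u. c (gen_a * u) = \<sigma> * c u" "\<And>u. c (gen_b * u) = \<beta> * c u" "c gen_x = 1"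
proof -
  define c where "c u = free_entry \<sigma> \<beta> (rep_algA u)" for u
  have c: "c (abs_algA p) = free_entry \<sigma> \<beta> p" for p
  proof -
    have "rel_cong (rep_algA (abs_algA p)) p"
      by (rule Quotient_rep_abs[OF Quotient_algA]) (simp add: rel_cong_def relation_ideal_0)
    then have "free_entry \<sigma> \<beta> (rep_algA (abs_algA p) - p) = 0"
      using free_entry_relation_ideal[OF assms] by (simp add: rel_cong_def)
    then show ?thesis by (simp add: c_def free_entry_diff)
  qed
  have left_scale: "c (abs_algA (Poly_Mapping.single w e) * u) = e * d * c u"
    if "\<And>v. word_entry \<sigma> \<beta> (w + v) = d * word_entry \<sigma> \<beta> v" for w d e u
    by (induction u rule: algA.abs_induct) (simp add: times_algA.abs_eq c free_entry_mult_single[OF that])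
  show ?thesis
  proof (rule that[of c])
    show "c (u + v) = c u + c v" for u v
      by (induction u rule: algA.abs_induct, induction v rule: algA.abs_induct)
        (simp add: plus_algA.abs_eq c free_entry_add)
    show "c (scal d u) = d * c u" for d u
      by (induction u rule: algA.abs_induct)
        (simp add: scal.abs_eq free_const_def c free_entry_mult_single[where d = 1])
    show "c (gen_a * u) = \<sigma> * c u" "c (gen_b * u) = \<beta> * c u" for u
      unfolding gen_a.abs_eq gen_b.abs_eq free_gen_def
      by (subst left_scale, auto simp: word_entry_def plus_word_def split: prod.split)+
    show "c gen_x = 1"
      by (simp add: gen_x.abs_eq free_gen_def c free_entry_single word_entry_def)
  qed
qed

section \<open>The idempotents\<close>

text \<open>
  The eigenvalue of \<open>a\<close> on \<open>e\<^sub>s\<close>.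
\<close>

definition sign_of :: "nat \<Rightarrow> 'k::field"
  where "sign_of s = (if s = 0 then 1 else - 1)"

lemma sign_of_square: "sign_of s * sign_of s = 1"
  by (simp add: sign_of_def)

lemma scal_uminus_one: "scal (- 1) u = - u"
  by (simp add: algA.scale_minus_left)

lemma gen_b_power_gen_x: "(gen_b ^ i * gen_x :: 'k::field algA) = scal ((- 1) ^ i) (gen_x * gen_b ^ i)"
proof (induction i)
  case (Suc i)
  have "(gen_b ^ Suc i * gen_x :: 'k algA) = gen_b * (gen_b ^ i * gen_x)" by (simp add: mult.assoc)
  also have "\<dots> = scal ((- 1) ^ i) ((gen_b * gen_x) * gen_b ^ i)"
    by (simp add: Suc scal_mult_right mult.assoc)
  also have "\<dots> = scal ((- 1) ^ Suc i) (gen_x * gen_b ^ Suc i)"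
    by (simp add: algA_relations mult.assoc algA.scale_minus_left algA.scale_minus_right)
  finally show ?case .
qed simp

lemma idem_e_altdef: "idem_e s = scal (1 / 2) (1 + scal (sign_of s) gen_a)"
  by (simp add: idem_e_def sign_of_def scal_uminus_one)

lemma gen_a_idem_e: "gen_a * idem_e s = scal (sign_of s) (idem_e s)"
  by (simp add: idem_e_altdef scal_mult_right distrib_left gen_a_gen_a sign_of_square
      algA.scale_right_distrib algA.scale_left_commute add.commute)

lemma double_eq_scal: "u + u = scal 2 u"
  using algA.scale_left_distrib[of 1 1 u] by simp

lemma idem_e_commutes:
  assumes "gen_a * u = u * gen_a"
  shows "idem_e s * u = u * idem_e s"
  using assms by (simp add: idem_e_def scal_mult_left scal_mult_right algebra_simps)

lemma idem_f_commutes: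
  assumes "gen_b * u = u * gen_b"
  shows "idem_f \<zeta> t * u = u * idem_f \<zeta> t"
  using power_commuting_commutes[OF assms]
  by (simp add: idem_f_def scal_mult_left scal_mult_right sum_distrib_left sum_distrib_right)

context
  fixes \<zeta> :: "'k::field"
  assumes prim: "primitive_root_of_unity 6 \<zeta>"
begin

lemma zeta_power_6: "\<zeta> ^ 6 = 1"
  and zeta_power_neq_1: "0 < k \<Longrightarrow> k < 6 \<Longrightarrow> \<zeta> ^ k \<noteq> 1"
  using prim by (auto simp: primitive_root_of_unity_def)

lemma zeta_neq_0: "\<zeta> \<noteq> 0"
  using zeta_power_6 by auto

lemma zeta_power_3: "\<zeta> ^ 3 = - 1"
proof -
  have "(\<zeta> ^ 3 - 1) * (\<zeta> ^ 3 + 1) = \<zeta> ^ 6 - 1" by (simp add: algebra_simps flip: power_add)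
  then have "\<zeta> ^ 3 + 1 = 0" using zeta_power_6 zeta_power_neq_1[of 3] by simp
  then show ?thesis by (simp add: eq_neg_iff_add_eq_0)
qed

text \<open>
  A primitive sixth root of unity can exist only if \<open>6\<close> is invertible, since \<open>z\<^sup>6 - 1\<close> is
  a square in characteristic \<open>2\<close> and a cube in characteristic \<open>3\<close>.
\<close>

lemma two_neq_0: "(2 :: 'k) \<noteq> 0"
proof
  assume "(2 :: 'k) = 0"
  then have "(1 :: 'k) = - 1" by (simp add: eq_neg_iff_add_eq_0)
  then show False using zeta_power_3 zeta_power_neq_1[of 3] by simp
qed

lemma three_neq_0: "(3 :: 'k) \<noteq> 0"
proof
  assume three: "(3 :: 'k) = 0"
  have "\<zeta> + 1 \<noteq> 0"
  proof
    assume "\<zeta> + 1 = 0"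
    then have "\<zeta> = - 1" by (simp add: eq_neg_iff_add_eq_0)
    then have "\<zeta> ^ 2 = 1" by simp
    then show False using zeta_power_neq_1[of 2] by simp
  qed
  moreover have "(\<zeta> + 1) ^ 3 = (\<zeta> ^ 3 + 1) + 3 * (\<zeta> ^ 2 + \<zeta>)"
    by (simp add: algebra_simps power2_eq_square power3_eq_cube)
  ultimately show False using three zeta_power_3 by simp
qed

lemma six_neq_0: "(6 :: 'k) \<noteq> 0"
proof -
  have "(6 :: 'k) = 2 * 3" by simp
  then show ?thesis using two_neq_0 three_neq_0 by (metis mult_eq_0_iff)
qed

lemma zeta_powi_add: "\<zeta> powi (t + u) = \<zeta> powi t * \<zeta> powi u"
  by (simp add: power_int_add zeta_neq_0)

lemma zeta_powi_add_3: "\<zeta> powi (t + 3) = - (\<zeta> powi t)"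
  using zeta_power_3 by (simp add: zeta_powi_add)

lemma zeta_powi_power_6: "(\<zeta> powi t) ^ 6 = 1"
  using zeta_power_6
  by (metis mult.commute power_int_1_left power_int_mult power_int_of_nat of_nat_numeral)

lemma zeta_powi_mod: "\<zeta> powi (t mod 6) = \<zeta> powi t"
proof -
  have "\<zeta> powi (6 * q + r) = \<zeta> powi r" for q r
    by (simp add: zeta_powi_add power_int_mult zeta_power_6)
  from this[of "t div 6" "t mod 6"] show ?thesis by simp
qed

lemma zeta_powi_eq_1_iff: "\<zeta> powi t = 1 \<longleftrightarrow> t mod 6 = 0"
proof
  assume "\<zeta> powi t = 1"
  then have "\<zeta> ^ nat (t mod 6) = 1"
    by (simp add: zeta_powi_mod flip: power_int_of_nat)
  moreover have "nat (t mod 6) < 6" by simp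
  ultimately show "t mod 6 = 0" using zeta_power_neq_1[of "nat (t mod 6)"] by (cases "nat (t mod 6) > 0") auto
next
  assume "t mod 6 = 0"
  then show "\<zeta> powi t = 1" using zeta_powi_mod[of t] by simp
qed

lemma idem_f_altdef: "idem_f \<zeta> t = scal (1 / 6) (\<Sum>i=0..5. scal ((\<zeta> powi t) ^ i) (gen_b ^ i))"
  unfolding idem_f_def by (simp add: power_int_mult)

text \<open>
  Multiplication by \<open>b\<close> shifts the summands of \<open>f\<^sub>t\<close> cyclically, up to the factor
  \<open>\<zeta>\<^sup>t\<close>.
\<close>

lemma gen_b_idem_f: "gen_b * idem_f \<zeta> t = scal (\<zeta> powi (- t)) (idem_f \<zeta> t)"
proof -
  define \<omega> where "\<omega> = \<zeta> powi t"
  define g where "g i = scal (\<omega> ^ i) (gen_b ^ i)" for i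
  have "\<omega> ^ 6 = 1" by (simp add: \<omega>_def zeta_powi_power_6)
  then have g6: "g 6 = g 0" by (simp add: g_def algA_relations)
  have "scal \<omega> (gen_b * (\<Sum>i=0..5. g i)) = (\<Sum>i=0..5. g (Suc i))"
    by (simp add: g_def sum_distrib_left scal_mult_right algA.scale_sum_right)
  also have "\<dots> = (\<Sum>i=0..5. g i) - g 0 + g 6"
    by (simp add: eval_nat_numeral)
  finally have "scal \<omega> (gen_b * (\<Sum>i=0..5. g i)) = (\<Sum>i=0..5. g i)" using g6 by simp
  then have "scal (inverse \<omega>) (scal \<omega> (gen_b * (\<Sum>i=0..5. g i))) = scal (inverse \<omega>) (\<Sum>i=0..5. g i)"
    by simp
  moreover have "\<omega> \<noteq> 0" using zeta_neq_0 by (simp add: \<omega>_def)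
  moreover have "idem_f \<zeta> t = scal (1 / 6) (\<Sum>i=0..5. g i)" by (simp add: idem_f_altdef \<omega>_def g_def)
  ultimately show ?thesis
    by (simp add: power_int_minus \<omega>_def scal_mult_right mult.commute)
qed

lemma idem_e_eigenvector:
  fixes u :: "'k algA"
  assumes "gen_a * u = scal (sign_of s) u"
  shows "idem_e s * u = u"
  using assms two_neq_0
  by (simp add: idem_e_altdef scal_mult_left distrib_right sign_of_square double_eq_scal)

text \<open>
  On an eigenvector with the matching eigenvalue each of the six summands \<open>\<zeta>\<^sup>t\<^sup>i b\<^sup>i\<close> acts as
  the identity. Idempotence of \<open>f\<^sub>t\<close> is the special case \<open>u = f\<^sub>t\<close>.
\<close>

lemma idem_f_eigenvector:
  fixes u :: "'k algA"
  assumes "gen_b * u = scal (\<zeta> powi (- t)) u"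
  shows "idem_f \<zeta> t * u = u"
proof -
  have "gen_b ^ i * u = scal ((\<zeta> powi (- t)) ^ i) u" for i
    by (induction i) (simp_all add: assms mult.assoc scal_mult_right mult.commute)
  moreover have "(\<zeta> powi t) ^ i * (\<zeta> powi (- t)) ^ i = 1" for i
    using zeta_neq_0 by (simp add: power_int_minus flip: power_mult_distrib)
  ultimately have "idem_f \<zeta> t * u = scal (1 / 6) (scal 6 u)"
    by (simp add: idem_f_altdef scal_mult_left sum_distrib_right algA.sum_constant_scale
        del: sum_constant)
  then show ?thesis using six_neq_0 by simp
qed

text \<open>
  Moving \<open>b\<^sup>i\<close> past \<open>x\<close> costs the sign \<open>(- 1)\<^sup>i = \<zeta>\<^sup>3\<^sup>i\<close>, which shifts the index by
  \<open>3\<close>.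
\<close>

lemma gen_x_idem_f: "gen_x * idem_f \<zeta> t = idem_f \<zeta> (t + 3) * gen_x"
  unfolding idem_f_altdef zeta_powi_add_3
  by (simp add: scal_mult_left scal_mult_right sum_distrib_left sum_distrib_right gen_b_power_gen_x
      flip: power_mult_distrib)

lemma sum_idem_f: "(\<Sum>t\<in>{0..5::int}. idem_f \<zeta> t) = 1"
proof -
  have geom: "(\<Sum>t\<in>{0..5::int}. (\<zeta> powi t) ^ i) = (if i = 0 then 6 else 0)" if "i \<le> 5" for i
  proof -
    let ?q = "\<zeta> ^ i"
    have "(\<zeta> powi t) ^ i = ?q powi t" for t
      by (metis mult.commute power_int_mult power_int_of_nat)
    moreover have "{0..5::int} = {0, 1, 2, 3, 4, 5}" by auto
    ultimately have eq: "(\<Sum>t\<in>{0..5::int}. (\<zeta> powi t) ^ i) = 1 + ?q + ?q ^ 2 + ?q ^ 3 + ?q ^ 4 + ?q ^ 5"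
      by simp
    have "(?q - 1) * (1 + ?q + ?q ^ 2 + ?q ^ 3 + ?q ^ 4 + ?q ^ 5) = ?q ^ 6 - 1"
      by (simp add: algebra_simps eval_nat_numeral)
    also have "\<dots> = 0"
      using zeta_power_6 by (simp flip: power_mult) (metis mult.commute power_mult power_one)
    finally show ?thesis using zeta_power_neq_1[of i] that eq by (cases "i = 0") auto
  qed
  have "(\<Sum>t\<in>{0..5::int}. idem_f \<zeta> t) =
      scal (1 / 6) (\<Sum>i=0..5. \<Sum>t\<in>{0..5::int}. scal ((\<zeta> powi t) ^ i) (gen_b ^ i))"
    unfolding idem_f_altdef algA.scale_sum_right[symmetric] by (subst sum.swap) simp
  also have "\<dots> = scal (1 / 6) (\<Sum>i\<in>{0..5::nat}. if i = 0 then scal 6 1 else 0)"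
    by (intro arg_cong[where f = "scal _"] sum.cong) (simp_all add: geom flip: algA.scale_sum_left)
  finally show ?thesis using six_neq_0 by simp
qed

lemma gen_a_idem: "gen_a * idem \<zeta> s t = scal (sign_of s) (idem \<zeta> s t)"
  by (simp add: idem_def gen_a_idem_e scal_mult_left flip: mult.assoc)

lemma idem_e_idem_f_commute: "idem_e s * idem_f \<zeta> t = idem_f \<zeta> t * idem_e s"
proof (rule idem_f_commutes[symmetric])
  show "gen_b * idem_e s = idem_e s * gen_b"
    by (rule idem_e_commutes[symmetric]) (rule algA_relations(4))
qed

lemma gen_b_idem: "gen_b * idem \<zeta> s t = scal (\<zeta> powi (- t)) (idem \<zeta> s t)"
  unfolding idem_def idem_e_idem_f_commute
  by (simp add: gen_b_idem_f scal_mult_left flip: mult.assoc)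

lemma idem_gen_a: "idem \<zeta> s t * gen_a = gen_a * idem \<zeta> s t"
proof -
  have "idem \<zeta> s t * gen_a = idem_e s * gen_a * idem_f \<zeta> t"
    by (simp add: idem_def mult.assoc idem_f_commutes algA_relations)
  then show ?thesis by (simp add: idem_def idem_e_commutes mult.assoc)
qed

lemma idem_gen_b: "idem \<zeta> s t * gen_b = gen_b * idem \<zeta> s t"
proof -
  have "idem \<zeta> s t * gen_b = idem_e s * gen_b * idem_f \<zeta> t"
    by (simp add: idem_def mult.assoc idem_f_commutes)
  then show ?thesis by (simp add: idem_def idem_e_commutes algA_relations mult.assoc)
qed

lemma gen_x_idem: "gen_x * idem \<zeta> s t = idem \<zeta> s (t + 3) * gen_x"
proof -
  have "gen_x * idem \<zeta> s t = idem_e s * (gen_x * idem_f \<zeta> t)"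
    by (simp add: idem_def idem_e_commutes algA_relations flip: mult.assoc)
  then show ?thesis by (simp add: idem_def gen_x_idem_f mult.assoc)
qed

lemma idem_eigenvector:
  fixes u :: "'k algA"
  assumes "gen_a * u = scal (sign_of s) u" "gen_b * u = scal (\<zeta> powi (- t)) u"
  shows "idem \<zeta> s t * u = u"
  by (simp add: idem_def mult.assoc idem_e_eigenvector idem_f_eigenvector assms)

lemma idem_idem: "idem \<zeta> s t * idem \<zeta> s t = idem \<zeta> s t"
  by (intro idem_eigenvector gen_a_idem gen_b_idem)

lemma sum_idem: "(\<Sum>s\<in>{0..1}. \<Sum>t\<in>{0..5}. idem \<zeta> s t) = 1"
proof -
  have "{0..1} = {0, 1 :: nat}" by auto
  moreover have "idem_e 0 + idem_e 1 = (1 :: 'k algA)"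
  proof -
    have "idem_e 0 + idem_e 1 = scal (1 / 2) ((1 + gen_a) + (1 - gen_a) :: 'k algA)"
      by (simp add: idem_e_def flip: algA.scale_right_distrib)
    also have "(1 + gen_a) + (1 - gen_a) = (scal 2 1 :: 'k algA)"
      by (simp flip: double_eq_scal)
    finally show ?thesis using two_neq_0 by simp
  qed
  ultimately show ?thesis
    by (simp add: idem_def sum_idem_f flip: sum_distrib_left distrib_right)
qed

lemma idem_mod: "idem \<zeta> s (t mod 6) = idem \<zeta> s t"
  by (simp add: idem_def idem_f_altdef zeta_powi_mod)

text \<open>
  The product of two of the idempotents is a common eigenvector of \<open>a\<close> and \<open>b\<close> for the
  eigenvalues of either factor, so for a non-zero product the eigenvalues agree.
\<close>

lemma idem_orthogonal:
  assumes st: "s \<in> {0..1}" "s' \<in> {0..1}" "t \<in> {0..5}" "t' \<in> {0..5}"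
    and neq: "idem \<zeta> s' t' * idem \<zeta> s t \<noteq> 0"
  shows "s = s'" "t = t'"
proof -
  let ?u = "idem \<zeta> s' t' * idem \<zeta> s t"
  have "scal (sign_of s') ?u = gen_a * ?u" "scal (\<zeta> powi (- t')) ?u = gen_b * ?u"
    by (simp_all add: gen_a_idem gen_b_idem scal_mult_left flip: mult.assoc)
  moreover have "gen_a * ?u = idem \<zeta> s' t' * (gen_a * idem \<zeta> s t)"
      "gen_b * ?u = idem \<zeta> s' t' * (gen_b * idem \<zeta> s t)"
    by (simp_all add: idem_gen_a idem_gen_b flip: mult.assoc)
  then have "gen_a * ?u = scal (sign_of s) ?u" "gen_b * ?u = scal (\<zeta> powi (- t)) ?u"
    by (simp_all add: gen_a_idem gen_b_idem scal_mult_right)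
  ultimately have "sign_of s' = (sign_of s :: 'k)" and zz: "\<zeta> powi (- t') = \<zeta> powi (- t)"
    using neq by (metis algA.scale_cancel_right)+
  moreover have "(1 :: 'k) \<noteq> - 1" using two_neq_0 by (simp add: eq_neg_iff_add_eq_0)
  ultimately show "s = s'" using st by (auto simp: sign_of_def split: if_splits)
  have "\<zeta> powi (t - t') = \<zeta> powi t * \<zeta> powi (- t')"
    using zeta_powi_add[of t "- t'"] by simp
  also have "\<dots> = \<zeta> powi t * \<zeta> powi (- t)" by (simp only: zz)
  also have "\<dots> = 1" using zeta_neq_0 by (simp add: power_int_minus)
  finally have "(t - t') mod 6 = 0" by (simp only: zeta_powi_eq_1_iff)
  then show "t = t'" using st(3,4) unfolding atLeastAtMost_iff by presburger
qed

text \<open>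
  In the representation in which \<open>a\<close> and \<open>b\<close> act on the first basis vector with their
  eigenvalues on \<open>e\<close>, the idempotent \<open>e\<close> fixes that vector, so the matrix coefficient of
  \<open>e x\<close> is that of \<open>x\<close>.
\<close>

lemma idem_gen_x_neq_0: "idem \<zeta> s t * gen_x \<noteq> 0"
proof -
  have "(sign_of s :: 'k) ^ 2 = 1" by (simp add: power2_eq_square sign_of_square)
  then obtain c :: "'k algA \<Rightarrow> 'k" where c: "\<And>u v. c (u + v) = c u + c v" "\<And>d u. c (scal d u) = d * c u"
    "\<And>u. c (gen_a * u) = sign_of s * c u" "\<And>u. c (gen_b * u) = \<zeta> powi (- t) * c u" "c gen_x = 1"
    using matrix_coefficient_exists[OF _ zeta_powi_power_6[of "- t"]] by metis
  have c0: "c 0 = 0" using c(2)[of 0 0] by simp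
  have sum: "c (sum g S) = (\<Sum>i\<in>S. c (g i))" for g and S :: "nat set"
    by (induction S rule: infinite_finite_induct) (simp_all add: c(1) c0)
  have pow: "c (gen_b ^ i * u) = (\<zeta> powi (- t)) ^ i * c u" for i u
    by (induction i) (simp_all add: c mult.assoc)
  have cancel: "(\<zeta> powi t) ^ i * ((\<zeta> powi (- t)) ^ i * y) = y" for i y
    using zeta_neq_0 by (simp add: power_int_minus flip: mult.assoc power_mult_distrib)
  have f: "c (idem_f \<zeta> t * u) = c u" for u
    using six_neq_0
    by (simp add: idem_f_altdef scal_mult_left sum_distrib_right c(2) sum pow cancel)
  have e: "c (idem_e s * u) = c u" for u
    using two_neq_0
    by (simp add: idem_e_altdef scal_mult_left c distrib_right sign_of_square flip: mult.assoc mult_2)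
  show ?thesis using f e c(5) c0 by (metis idem_def mult.assoc zero_neq_one)
qed


section \<open>The right ideals \<open>N\<^sub>s\<^sub>,\<^sub>t\<^sub>,\<^sub>m\<close>\<close>

abbreviation (input) N :: "nat \<Rightarrow> int \<Rightarrow> nat \<Rightarrow> 'k algA set"
  where "N \<equiv> N_ideal \<zeta>"

lemma mem_N_0_iff:
  "u \<in> N s t 0 \<longleftrightarrow> (\<exists>\<alpha> \<beta>. u = scal \<alpha> (idem \<zeta> s t) + scal \<beta> (idem \<zeta> s t * gen_x))"
proof -
  have "u \<in> N s t 0 \<longleftrightarrow> (\<exists>r\<in>subalg_R. u = idem \<zeta> s t * r)" by (auto simp: N_ideal_def)
  also have "\<dots> \<longleftrightarrow> (\<exists>\<alpha> \<beta>. u = idem \<zeta> s t * (scal \<alpha> 1 + scal \<beta> gen_x))"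
    unfolding Bex_def mem_subalg_R_iff by blast
  finally show ?thesis by (simp add: distrib_left scal_mult_right)
qed

lemma mem_N_1_iff: "u \<in> N s t 1 \<longleftrightarrow> (\<exists>\<alpha>. u = scal \<alpha> (idem \<zeta> s t * gen_x))"
proof -
  have "u \<in> N s t 1 \<longleftrightarrow> (\<exists>r\<in>subalg_R. u = idem \<zeta> s t * gen_x * r)" by (auto simp: N_ideal_def)
  also have "\<dots> \<longleftrightarrow> (\<exists>\<alpha> \<beta>. u = idem \<zeta> s t * gen_x * (scal \<alpha> 1 + scal \<beta> gen_x))"
    unfolding Bex_def mem_subalg_R_iff by blast
  finally show ?thesis by (simp add: distrib_left scal_mult_right mult.assoc gen_x_gen_x)
qed

lemma N_mod: "N s (t mod 6) m = N s t m"
  by (simp add: N_ideal_def idem_mod)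

lemma idem_gen_x_gen_a: "idem \<zeta> s t * gen_x * gen_a = scal (sign_of s) (idem \<zeta> s t * gen_x)"
proof -
  have "idem \<zeta> s t * gen_x * gen_a = (idem \<zeta> s t * gen_a) * gen_x"
    by (simp add: mult.assoc algA_relations)
  then show ?thesis by (simp add: idem_gen_a gen_a_idem scal_mult_left)
qed

lemma idem_gen_x_gen_b:
  "idem \<zeta> s t * gen_x * gen_b = scal (- (\<zeta> powi (- t))) (idem \<zeta> s t * gen_x)"
proof -
  have "gen_x * gen_b = - (gen_b * gen_x :: 'k algA)" by (simp add: algA_relations)
  then have "idem \<zeta> s t * gen_x * gen_b = - ((idem \<zeta> s t * gen_b) * gen_x)"
    by (simp add: mult.assoc)
  then show ?thesis by (simp add: idem_gen_b gen_b_idem scal_mult_left algA.scale_minus_left)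
qed

lemma right_ideal_N_0: "right_ideal (N s t 0)"
proof (rule right_ideal_if_subspace)
  have N: "N s t 0 = {scal \<alpha> (idem \<zeta> s t) + scal \<beta> (idem \<zeta> s t * gen_x) |\<alpha> \<beta>. True}"
    using mem_N_0_iff by blast
  show "algA.subspace (N s t 0)" unfolding N by (rule subspace_span_pair)
  fix u assume "u \<in> N s t 0"
  then obtain \<alpha> \<beta> where u: "u = scal \<alpha> (idem \<zeta> s t) + scal \<beta> (idem \<zeta> s t * gen_x)"
    using mem_N_0_iff by blast
  show "u * gen_a \<in> N s t 0"
    unfolding mem_N_0_iff u
    by (rule exI[of _ "\<alpha> * sign_of s"], rule exI[of _ "\<beta> * sign_of s"])
      (simp add: distrib_right scal_mult_left idem_gen_a gen_a_idem idem_gen_x_gen_a)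
  show "u * gen_b \<in> N s t 0"
    unfolding mem_N_0_iff u
    by (rule exI[of _ "\<alpha> * \<zeta> powi (- t)"], rule exI[of _ "- (\<beta> * \<zeta> powi (- t))"])
      (simp add: distrib_right scal_mult_left idem_gen_b gen_b_idem idem_gen_x_gen_b)
  show "u * gen_x \<in> N s t 0"
    unfolding mem_N_0_iff u
    by (rule exI[of _ 0], rule exI[of _ \<alpha>])
      (simp add: distrib_right scal_mult_left mult.assoc gen_x_gen_x)
qed

lemma right_ideal_N_1: "right_ideal (N s t 1)"
proof (rule right_ideal_if_subspace)
  have N: "N s t 1 = {scal \<alpha> (idem \<zeta> s t * gen_x) + scal \<beta> 0 |\<alpha> \<beta>. True}"
    using mem_N_1_iff by auto
  show "algA.subspace (N s t 1)" unfolding N by (rule subspace_span_pair)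
  fix u assume "u \<in> N s t 1"
  then obtain \<alpha> where u: "u = scal \<alpha> (idem \<zeta> s t * gen_x)"
    using mem_N_1_iff by blast
  show "u * gen_a \<in> N s t 1"
    unfolding mem_N_1_iff u
    by (rule exI[of _ "\<alpha> * sign_of s"]) (simp add: scal_mult_left idem_gen_x_gen_a)
  show "u * gen_b \<in> N s t 1"
    unfolding mem_N_1_iff u
    by (rule exI[of _ "- (\<alpha> * \<zeta> powi (- t))"]) (simp add: scal_mult_left idem_gen_x_gen_b)
  show "u * gen_x \<in> N s t 1"
    unfolding mem_N_1_iff u
    by (rule exI[of _ 0]) (simp add: scal_mult_left mult.assoc gen_x_gen_x)
qed

lemma idem_in_N: "idem \<zeta> s t \<in> N s t 0"
  unfolding mem_N_0_iff by (rule exI[of _ 1], rule exI[of _ 0]) simp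

lemma idem_gen_x_in_N: "idem \<zeta> s t * gen_x \<in> N s t 1"
  unfolding mem_N_1_iff by (rule exI[of _ 1]) simp

text \<open>
  Writing \<open>u = \<alpha> e + \<beta> e x\<close>, one has \<open>\<alpha> \<noteq> 0\<close> and \<open>u x = \<alpha> e x\<close>; so
  \<open>J\<close> contains \<open>e x\<close>, and then \<open>e\<close>. This makes \<open>e A\<close> uniserial.
\<close>

lemma right_ideal_eq_N_0:
  assumes J: "right_ideal J" and "J \<subseteq> N s t 0" and "u \<in> J" "u * gen_x \<noteq> 0"
  shows "J = N s t 0"
proof -
  let ?e = "idem \<zeta> s t"
  obtain \<alpha> \<beta> where u: "u = scal \<alpha> ?e + scal \<beta> (?e * gen_x)"
    using assms mem_N_0_iff by blast
  then have ux: "u * gen_x = scal \<alpha> (?e * gen_x)"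
    by (simp add: distrib_right scal_mult_left mult.assoc gen_x_gen_x)
  then have \<alpha>: "\<alpha> \<noteq> 0" using assms(4) by auto
  have "scal (inverse \<alpha>) (u * gen_x) \<in> J"
    using assms by (intro right_ideal_scal[OF J] right_ideal_mult[OF J])
  then have ex: "?e * gen_x \<in> J" using \<alpha> by (simp add: ux)
  have "scal (inverse \<alpha>) (u - scal \<beta> (?e * gen_x)) \<in> J"
    using assms ex by (intro right_ideal_scal[OF J] right_ideal_diff[OF J])
  then have "?e \<in> J" using \<alpha> by (simp add: u)
  then have "scal \<alpha> ?e + scal \<beta> (?e * gen_x) \<in> J" for \<alpha> \<beta>
    using ex by (intro right_ideal_add[OF J] right_ideal_scal[OF J])
  then have "N s t 0 \<subseteq> J" unfolding subset_iff mem_N_0_iff by blast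
  then show ?thesis using assms(2) by blast
qed

text \<open>
  The generator \<open>e\<close> is not killed by \<open>x\<close>. So one of its two components is not either, and
  the summand that contains this component is everything.
\<close>

lemma indecomposable_N_0: "indecomposable_right_ideal (N s t 0)"
  unfolding indecomposable_right_ideal_def
proof (intro conjI allI impI)
  let ?e = "idem \<zeta> s t"
  show "right_ideal (N s t 0)" by (rule right_ideal_N_0)
  show "N s t 0 \<noteq> {0}" 
    using idem_in_N[of s t] idem_gen_x_neq_0[of s t] by (metis mult_zero_left singletonD)
  fix J K
  assume "right_ideal J \<and> right_ideal K \<and> {u + v |u v. u \<in> J \<and> v \<in> K} = N s t 0 \<and> J \<inter> K = {0}"
  then have J: "right_ideal J" and K: "right_ideal K"
    and sum: "{u + v |u v. u \<in> J \<and> v \<in> K} = N s t 0" and int: "J \<inter> K = {0}" by blast+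
  have sub: "J \<subseteq> N s t 0" "K \<subseteq> N s t 0" by (rule right_ideal_sum_superset[OF J K sum])+
  obtain u v where uv: "u \<in> J" "v \<in> K" "?e = u + v" using idem_in_N[of s t] sum by blast
  then have "u * gen_x + v * gen_x \<noteq> 0"
    using idem_gen_x_neq_0[of s t] by (simp flip: distrib_right)
  then have "u * gen_x \<noteq> 0 \<or> v * gen_x \<noteq> 0" by auto
  then have "J = N s t 0 \<or> K = N s t 0"
    using right_ideal_eq_N_0[OF J sub(1) uv(1)] right_ideal_eq_N_0[OF K sub(2) uv(2)] by blast
  then show "J = {0} \<or> K = {0}" using sub int by blast
qed

lemma indecomposable_N_1: "indecomposable_right_ideal (N s t 1)"
  unfolding indecomposable_right_ideal_def
proof (intro conjI allI impI)
  let ?v = "idem \<zeta> s t * gen_x"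
  show "right_ideal (N s t 1)" by (rule right_ideal_N_1)
  show "N s t 1 \<noteq> {0}" 
    using idem_gen_x_in_N[of s t] idem_gen_x_neq_0[of s t] by (metis singletonD)
  have gen: "?v \<in> J" if J: "right_ideal J" "J \<subseteq> N s t 1" "J \<noteq> {0}" for J
  proof -
    obtain u where u: "u \<in> J" "u \<noteq> 0" using J right_ideal_0[OF J(1)] by blast
    then obtain \<alpha> where \<alpha>: "u = scal \<alpha> ?v" using J(2) mem_N_1_iff by blast
    then have "?v = scal (inverse \<alpha>) u" using u(2) by auto
    then show ?thesis using right_ideal_scal[OF J(1) u(1)] by metis
  qed
  fix J K
  assume "right_ideal J \<and> right_ideal K \<and> {u + v |u v. u \<in> J \<and> v \<in> K} = N s t 1 \<and> J \<inter> K = {0}"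
  then have J: "right_ideal J" and K: "right_ideal K"
    and sum: "{u + v |u v. u \<in> J \<and> v \<in> K} = N s t 1" and int: "J \<inter> K = {0}" by blast+
  have "J \<subseteq> N s t 1" "K \<subseteq> N s t 1" by (rule right_ideal_sum_superset[OF J K sum])+
  then have "J = {0} \<or> ?v \<in> J" "K = {0} \<or> ?v \<in> K"
    using gen[OF J] gen[OF K] by auto
  moreover have "?v \<notin> J \<inter> K" unfolding int using idem_gen_x_neq_0[of s t] by simp
  ultimately show "J = {0} \<or> K = {0}" by auto
qed

lemma indecomposable_N: "m \<in> {0..1} \<Longrightarrow> indecomposable_right_ideal (N s t m)"
  using indecomposable_N_0 indecomposable_N_1 by (cases "m = 0") (auto simp: le_Suc_eq)

text \<open>
  An isomorphism respects annihilation by \<open>x\<close>, which gives \<open>m = m'\<close>. For \<open>(s, t)\<close> it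
  is enough that \<open>e' e \<noteq> 0\<close>: the image of a generator is unchanged when the generator is
  multiplied on the right by the idempotent that fixes it, and if \<open>e' e\<close> were \<open>0\<close> then
  the result would be killed by \<open>x\<close> (for \<open>m = 0\<close>) or vanish (for \<open>m = 1\<close>), and
  an injective module map allows neither.
\<close>

lemma N_iso_imp_eq:
  assumes ranges: "s \<in> {0..1}" "s' \<in> {0..1}" "t \<in> {0..5}" "t' \<in> {0..5}" "m \<in> {0..1}" "m' \<in> {0..1}"
    and iso: "right_module_iso (N s t m) (N s' t' m')"
  shows "s = s'" "t = t'" "m = m'"
proof -
  let ?e = "idem \<zeta> s t" and ?e' = "idem \<zeta> s' t'"
  obtain \<phi> where bij: "bij_betw \<phi> (N s t m) (N s' t' m')"
    and add: "\<And>u v. u \<in> N s t m \<Longrightarrow> v \<in> N s t m \<Longrightarrow> \<phi> (u + v) = \<phi> u + \<phi> v"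
    and mult: "\<And>u r. u \<in> N s t m \<Longrightarrow> \<phi> (u * r) = \<phi> u * r"
    using iso unfolding right_module_iso_def by blast
  have I: "right_ideal (N s t m)" and I': "right_ideal (N s' t' m')"
    using ranges indecomposable_N by (auto simp: indecomposable_right_ideal_def)
  have zero: "\<phi> 0 = 0" using mult[OF right_ideal_0[OF I], of 0] by simp
  have surj: "\<phi> u \<in> N s' t' m'" if "u \<in> N s t m" for u using bij that by (auto simp: bij_betw_def)
  have nonzero: "\<phi> u \<noteq> 0" if "u \<in> N s t m" "u \<noteq> 0" for u
    using bij that zero right_ideal_0[OF I] unfolding bij_betw_def inj_on_def by metis
  have kill: "u * gen_x = 0" if u: "u \<in> N s t 1" for s t u
  proof -
    obtain \<alpha> where "u = scal \<alpha> (idem \<zeta> s t * gen_x)" using u mem_N_1_iff by blast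
    then show ?thesis by (simp add: scal_mult_left mult.assoc gen_x_gen_x)
  qed
  have m: "m = m'"
  proof (rule ccontr)
    assume "m \<noteq> m'"
    then consider "m = 0" "m' = 1" | "m = 1" "m' = 0" using ranges by fastforce
    then show False
    proof cases
      case 1
      have "\<phi> (?e * gen_x) = \<phi> ?e * gen_x" using 1 idem_in_N by (simp add: mult)
      also have "\<dots> = 0" using 1 idem_in_N kill surj by blast
      finally show False
        using nonzero[of "?e * gen_x"] 1 idem_in_N idem_gen_x_neq_0 right_ideal_mult[OF I] by blast
    next
      case 2
      obtain u where u: "u \<in> N s t m" "?e' = \<phi> u"
        using bij 2 idem_in_N[of s' t'] unfolding bij_betw_def by blast
      then have "?e' * gen_x = \<phi> (u * gen_x)" by (simp add: mult)
      also have "u * gen_x = 0" using 2 kill u by blast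
      finally show False using zero idem_gen_x_neq_0 by simp
    qed
  qed
  show "m = m'" by (rule m)
  have "?e' * ?e \<noteq> 0"
  proof (cases "m = 0")
    case True
    have e: "?e \<in> N s t m" using True idem_in_N by simp
    obtain \<alpha> \<beta> where w: "\<phi> ?e = scal \<alpha> ?e' + scal \<beta> (?e' * gen_x)"
      using surj[OF e] m True mem_N_0_iff by blast
    have "\<phi> ?e * ?e * gen_x = \<phi> ?e * gen_x"
      using mult[OF e, of ?e] by (simp add: idem_idem)
    also have "\<dots> = \<phi> (?e * gen_x)" by (rule mult[OF e, symmetric])
    also have "\<dots> \<noteq> 0" using e nonzero idem_gen_x_neq_0 right_ideal_mult[OF I] by blast
    also have "\<phi> ?e * ?e * gen_x = scal \<alpha> (?e' * ?e * gen_x) + scal \<beta> (?e' * (gen_x * ?e) * gen_x)"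
      by (simp add: w distrib_right scal_mult_left mult.assoc)
    also have "?e' * (gen_x * ?e) * gen_x = 0"
      by (simp add: gen_x_idem mult.assoc gen_x_gen_x)
    finally show ?thesis by auto
  next
    case False
    then have m1: "m = 1" "m' = 1" using m ranges by auto
    have v: "?e * gen_x \<in> N s t m" using m1 idem_gen_x_in_N by simp
    obtain \<beta> where w: "\<phi> (?e * gen_x) = scal \<beta> (?e' * gen_x)"
      using surj[OF v] m1 mem_N_1_iff by blast
    \<comment> \<open>the generator \<open>e x\<close> is fixed by the idempotent of index \<open>t + 3\<close>, as \<open>t + 6\<close> counts as \<open>t\<close>\<close>
    have x: "gen_x * idem \<zeta> s (t + 3) = ?e * gen_x"
      using gen_x_idem[of s "t + 3"] idem_mod[of s "t + 6"] idem_mod[of s t]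
      by (simp add: add.assoc)
    have "\<phi> (?e * gen_x) = \<phi> (?e * gen_x * idem \<zeta> s (t + 3))"
      by (simp add: mult.assoc x) (simp add: idem_idem flip: mult.assoc)
    also have "\<dots> = \<phi> (?e * gen_x) * idem \<zeta> s (t + 3)" by (rule mult[OF v])
    also have "\<dots> = scal \<beta> (?e' * (gen_x * idem \<zeta> s (t + 3)))"
      by (simp add: w scal_mult_left mult.assoc)
    also have "\<dots> = scal \<beta> (?e' * ?e * gen_x)" by (simp add: x mult.assoc)
    finally show ?thesis using nonzero[OF v] idem_gen_x_neq_0 by auto
  qed
  then show "s = s'" "t = t'" using idem_orthogonal ranges by blast+
qed

section \<open>Classification\<close>

lemma left_mult_idem: "\<exists>\<alpha> \<beta>. r * idem \<zeta> s t = scal \<alpha> (idem \<zeta> s t) + scal \<beta> (gen_x * idem \<zeta> s t)"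
proof -
  let ?e = "idem \<zeta> s t"
  let ?M = "{scal \<alpha> ?e + scal \<beta> (gen_x * ?e) |\<alpha> \<beta>. True}"
  have ax: "gen_a * (gen_x * ?e) = scal (sign_of s) (gen_x * ?e)"
  proof -
    have "gen_a * (gen_x * ?e) = gen_x * (gen_a * ?e)"
      by (simp add: algA_relations flip: mult.assoc)
    then show ?thesis by (simp add: gen_a_idem scal_mult_right)
  qed
  have bx: "gen_b * (gen_x * ?e) = scal (- (\<zeta> powi (- t))) (gen_x * ?e)"
  proof -
    have "gen_b * (gen_x * ?e) = - (gen_x * (gen_b * ?e))"
      by (simp add: algA_relations flip: mult.assoc)
    then show ?thesis by (simp add: gen_b_idem scal_mult_right algA.scale_minus_left)
  qed
  have "r * ?e \<in> ?M"
  proof (rule left_mult_closed_if_subspace)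
    show "algA.subspace ?M" by (rule subspace_span_pair)
    show "?e \<in> ?M" by (rule CollectI, rule exI[of _ 1], rule exI[of _ 0]) simp
    fix u assume "u \<in> ?M"
    then obtain \<alpha> \<beta> where u: "u = scal \<alpha> ?e + scal \<beta> (gen_x * ?e)" by blast
    have "gen_a * u = scal (\<alpha> * sign_of s) ?e + scal (\<beta> * sign_of s) (gen_x * ?e)"
      by (simp add: u distrib_left scal_mult_right gen_a_idem ax)
    then show "gen_a * u \<in> ?M" by blast
    have "gen_b * u = scal (\<alpha> * \<zeta> powi (- t)) ?e + scal (- (\<beta> * \<zeta> powi (- t))) (gen_x * ?e)"
      by (simp add: u distrib_left scal_mult_right gen_b_idem bx)
    then show "gen_b * u \<in> ?M" by blast
    have "gen_x * u = scal 0 ?e + scal \<alpha> (gen_x * ?e)"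
      by (simp add: u distrib_left scal_mult_right gen_x_gen_x_left)
    then show "gen_x * u \<in> ?M" by blast
  qed
  then show ?thesis by blast
qed

lemma exists_nonzero_component:
  assumes "u \<noteq> 0"
  obtains s t where "s \<in> {0..1}" "u * idem \<zeta> s t \<noteq> 0"
proof -
  have "(\<Sum>s\<in>{0..1}. \<Sum>t\<in>{0..5}. u * idem \<zeta> s t) = u"
    using sum_idem by (simp flip: sum_distrib_left)
  then have "\<not> (\<forall>s\<in>{0..1}. \<forall>t\<in>{0..5}. u * idem \<zeta> s t = 0)"
    using assms by (metis (no_types, lifting) sum.neutral)
  then show ?thesis using that by blast
qed

text \<open>
  The idempotents commute with \<open>a\<close> and \<open>b\<close>; for \<open>x\<close> both sides are \<open>0\<close>. So right
  multiplication by an idempotent is an endomorphism of such a right ideal.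
\<close>

lemma idem_commutes_on_ideal_killed_by_gen_x:
  assumes I: "right_ideal I" and kill: "\<And>u. u \<in> I \<Longrightarrow> u * gen_x = 0" and u: "u \<in> I"
  shows "u * r * idem \<zeta> s t = u * idem \<zeta> s t * r"
proof -
  let ?e = "idem \<zeta> s t"
  let ?C = "{r. \<forall>u\<in>I. u * r * ?e = u * ?e * r}"
  have "r \<in> ?C"
  proof (rule subalgebra_containing_generators)
    show "gen_a \<in> ?C" "gen_b \<in> ?C"
      by (simp_all add: idem_gen_a idem_gen_b mult.assoc)
    show "gen_x \<in> ?C"
      using kill right_ideal_mult[OF I] by simp
    have "u * (r * r') * ?e = u * ?e * (r * r')" if "r \<in> ?C" "r' \<in> ?C" "u \<in> I" for u r r'
    proof -
      have "u * r * r' * ?e = u * r * ?e * r'" using that right_ideal_mult[OF I] by simp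
      then show ?thesis using that by (simp flip: mult.assoc)
    qed
    then show "subalgebra ?C"
      by (simp add: subalgebra_def algA.subspace_def distrib_left distrib_right scal_mult_left
          scal_mult_right)
  qed
  then show ?thesis using u by blast
qed

text \<open>
  Right multiplication by a suitable \<open>e\<close> is the identity of \<open>I\<close>, so \<open>I\<close> consists of
  elements \<open>\<alpha> e + \<beta> x e\<close>. As \<open>x\<close> kills them, \<open>\<alpha> = 0\<close>, and
  \<open>x e = e\<^sub>s\<^sub>,\<^sub>t\<^sub>+\<^sub>3 x\<close>.
\<close>

lemma indecomposable_killed_by_gen_x:
  assumes ind: "indecomposable_right_ideal I" and kill: "\<And>u. u \<in> I \<Longrightarrow> u * gen_x = 0"
  shows "\<exists>s\<in>{0..1}. \<exists>t. I = N s t 1"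
proof -
  have I: "right_ideal I" using ind by (simp add: indecomposable_right_ideal_def)
  obtain w where w: "w \<in> I" "w \<noteq> 0"
    using ind right_ideal_0[OF I] by (auto simp: indecomposable_right_ideal_def)
  obtain s t where s: "s \<in> {0..1}" and ne: "w * idem \<zeta> s t \<noteq> 0"
    using exists_nonzero_component[OF w(2)] by blast
  let ?e = "idem \<zeta> s t" and ?v = "idem \<zeta> s (t + 3) * gen_x"
  have "u * ?e = u" if "u \<in> I" for u
    by (rule indecomposable_idempotent_endomorphism[OF ind, where \<phi> = "\<lambda>u. u * ?e"])
      (use that w ne right_ideal_mult[OF I] idem_commutes_on_ideal_killed_by_gen_x[OF I kill] in
        \<open>simp_all add: distrib_right mult.assoc idem_idem\<close>)
  moreover have "\<exists>\<beta>. u * ?e = scal \<beta> ?v" if u: "u \<in> I" for u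
  proof -
    obtain \<alpha> \<beta> where ue: "u * ?e = scal \<alpha> ?e + scal \<beta> (gen_x * ?e)"
      using left_mult_idem by blast
    have "scal \<alpha> (?e * gen_x) = u * ?e * gen_x"
      by (simp add: ue distrib_right scal_mult_left gen_x_idem mult.assoc gen_x_gen_x)
    also have "\<dots> = 0" using u right_ideal_mult[OF I] kill by blast
    finally have "\<alpha> = 0" using idem_gen_x_neq_0 by simp
    then show ?thesis using ue by (auto simp: gen_x_idem)
  qed
  ultimately have sub: "u \<in> N s (t + 3) 1" if "u \<in> I" for u
    using that unfolding mem_N_1_iff by metis
  then obtain \<beta> where \<beta>: "w = scal \<beta> ?v" using w(1) unfolding mem_N_1_iff by blast
  then have "scal (inverse \<beta>) w = ?v" using w(2) by auto
  then have "?v \<in> I" using right_ideal_scal[OF I w(1)] by metis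
  then have "scal \<alpha> ?v \<in> I" for \<alpha> by (rule right_ideal_scal[OF I])
  then have "N s (t + 3) 1 \<subseteq> I" unfolding subset_iff mem_N_1_iff by blast
  then show ?thesis using sub s by blast
qed

lemma one_plus_scal_gen_x_inverse:
  "(1 + scal \<gamma> gen_x) * (1 - scal \<gamma> gen_x) = (1 :: 'k algA)"
  "(1 - scal \<gamma> gen_x) * (1 + scal \<gamma> gen_x) = (1 :: 'k algA)"
  by (simp_all add: algebra_simps scal_mult_left scal_mult_right gen_x_gen_x)

text \<open>
  Here \<open>I\<close> contains some \<open>g e\<close> with a unit \<open>g = 1 + \<gamma> x\<close>, and left multiplication by
  the idempotent \<open>g e g\<^sup>-\<^sup>1\<close> is the identity of \<open>I\<close>.
\<close>

lemma indecomposable_not_killed_by_gen_x: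
  assumes ind: "indecomposable_right_ideal I" and w: "w \<in> I" "w * gen_x \<noteq> 0"
  shows "\<exists>s\<in>{0..1}. \<exists>t \<gamma>. I = (*) (1 + scal \<gamma> gen_x) ` N s t 0"
proof -
  have I: "right_ideal I" using ind by (simp add: indecomposable_right_ideal_def)
  obtain s t where s: "s \<in> {0..1}" and ne: "w * gen_x * idem \<zeta> s t \<noteq> 0"
    using exists_nonzero_component[OF w(2)] by blast
  \<comment> \<open>the index \<open>t + 3\<close> is chosen such that \<open>e x = x e\<^sub>s\<^sub>,\<^sub>t\<close>, so that \<open>w e\<close> is not killed by \<open>x\<close>\<close>
  let ?e = "idem \<zeta> s (t + 3)"
  obtain \<alpha> \<beta> where v: "w * ?e = scal \<alpha> ?e + scal \<beta> (gen_x * ?e)"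
    using left_mult_idem by blast
  have "scal \<alpha> (?e * gen_x) = w * ?e * gen_x"
    by (simp add: v distrib_right scal_mult_left gen_x_idem mult.assoc gen_x_gen_x)
  also have "\<dots> = w * gen_x * idem \<zeta> s t" by (simp add: gen_x_idem mult.assoc)
  finally have \<alpha>: "\<alpha> \<noteq> 0" using ne by auto
  define \<gamma> where "\<gamma> = \<beta> / \<alpha>"
  define g h where "g = 1 + scal \<gamma> gen_x" and "h = 1 - scal \<gamma> gen_x"
  have hg: "h * g = 1" and gh: "g * h = 1"
    using one_plus_scal_gen_x_inverse by (simp_all add: g_def h_def)
  have ge: "w * scal (inverse \<alpha>) ?e = g * ?e"
    using \<alpha> by (simp add: scal_mult_right v algA.scale_right_distrib g_def \<gamma>_def distrib_right
        scal_mult_left divide_inverse mult.commute)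
  have gN: "g * n \<in> I" if n: "n \<in> N s (t + 3) 0" for n
  proof -
    obtain r where "n = ?e * r" using n by (auto simp: N_ideal_def)
    then have "g * n = w * scal (inverse \<alpha>) ?e * r" by (simp add: ge mult.assoc)
    then show ?thesis using right_ideal_mult[OF I] w(1) by metis
  qed
  have hgu: "h * (g * u) = u" and ghu: "g * (h * u) = u" for u
    using hg gh by (simp_all flip: mult.assoc)
  have eN: "?e * r \<in> N s (t + 3) 0" for r
    by (rule right_ideal_mult[OF right_ideal_N_0 idem_in_N])
  let ?\<phi> = "\<lambda>u. g * (?e * (h * u))"
  have ee: "?e * (?e * u) = ?e * u" for u by (simp add: idem_idem flip: mult.assoc)
  have "?\<phi> u = u" if "u \<in> I" for u
  proof (rule indecomposable_idempotent_endomorphism[OF ind, where \<phi> = ?\<phi>])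
    show "g * ?e \<in> I" by (rule gN[OF idem_in_N])
    have "g * ?e \<noteq> 0" using hgu[of ?e] idem_gen_x_neq_0[of s "t + 3"] by auto
    then show "?\<phi> (g * ?e) \<noteq> 0" by (simp add: hgu idem_idem)
  qed (use that gN eN in \<open>simp_all add: distrib_left mult.assoc hgu ee\<close>)
  then have "I \<subseteq> (*) g ` N s (t + 3) 0" using eN by (metis image_eqI subsetI)
  then have "I = (*) g ` N s (t + 3) 0" using gN by blast
  then show ?thesis using s unfolding g_def by blast
qed

lemma gen_x_left_mult_subalg_R:
  assumes "r \<in> subalg_R"
  obtains \<gamma> where "r * gen_x = scal \<gamma> (gen_x :: 'k algA)"
proof -
  obtain \<alpha> \<beta> where "r = scal \<alpha> 1 + scal \<beta> gen_x" using assms mem_subalg_R_iff by blast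
  then have "r * gen_x = scal \<alpha> gen_x" by (simp add: distrib_right scal_mult_left gen_x_gen_x)
  then show ?thesis by (rule that)
qed

text \<open>
  For \<open>r = \<alpha> + \<beta> x\<close> one has \<open>r x = \<alpha> x\<close>, so the factors \<open>1 + r x\<close> are exactly
  the units \<open>1 + \<gamma> x\<close>. The index \<open>t\<close> matters only modulo \<open>6\<close>.
\<close>

lemma indecomposable_right_ideal_iff:
  "indecomposable_right_ideal I \<longleftrightarrow>
    (\<exists>r s t m. I = (\<lambda>u. (1 + r * gen_x) * u) ` N s t m \<and>
      r \<in> subalg_R \<and> m \<in> {0..1} \<and> s \<in> {0..1} \<and> t \<in> {0..5})" (is "_ \<longleftrightarrow> ?R")
proof
  assume ind: "indecomposable_right_ideal I"
  have "\<exists>\<gamma> s t m. I = (*) (1 + scal \<gamma> gen_x) ` N s t m \<and> m \<in> {0..1} \<and> s \<in> {0..1}"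
  proof (cases "\<exists>w\<in>I. w * gen_x \<noteq> 0")
    case True
    then obtain s t \<gamma> where "s \<in> {0..1}" "I = (*) (1 + scal \<gamma> gen_x) ` N s t 0"
      using indecomposable_not_killed_by_gen_x[OF ind] by blast
    then show ?thesis by (intro exI[of _ \<gamma>] exI[of _ s] exI[of _ t] exI[of _ 0]) simp
  next
    case False
    then obtain s t where "s \<in> {0..1}" "I = N s t 1"
      using indecomposable_killed_by_gen_x[OF ind] by blast
    then show ?thesis by (intro exI[of _ 0] exI[of _ s] exI[of _ t] exI[of _ 1]) simp
  qed
  then obtain \<gamma> s t m where *: "I = (*) (1 + scal \<gamma> gen_x) ` N s t m" "m \<in> {0..1}" "s \<in> {0..1}"
    by blast
  have "scal \<gamma> 1 \<in> (subalg_R :: 'k algA set)"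
    unfolding mem_subalg_R_iff by (rule exI[of _ \<gamma>], rule exI[of _ 0]) simp
  moreover have "t mod 6 \<in> {0..5}" by auto
  ultimately show ?R
    using * by (intro exI[of _ "scal \<gamma> 1"] exI[of _ s] exI[of _ "t mod 6"] exI[of _ m])
      (simp add: N_mod scal_mult_left)
next
  assume ?R
  then obtain r s t m where I: "I = (*) (1 + r * gen_x) ` N s t m" and "r \<in> subalg_R" "m \<in> {0..1}"
    by blast
  then obtain \<gamma> where "r * gen_x = scal \<gamma> (gen_x :: 'k algA)" using gen_x_left_mult_subalg_R by blast
  then show "indecomposable_right_ideal I"
    using \<open>m \<in> {0..1}\<close>
    by (auto simp: I intro!: indecomposable_left_unit_mult indecomposable_N one_plus_scal_gen_x_inverse)
qed

lemma exists_N_iso: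
  assumes "indecomposable_right_ideal I"
  shows "\<exists>s t m. s \<in> {0..1} \<and> t \<in> {0..5} \<and> m \<in> {0..1} \<and> right_module_iso I (N s t m)"
proof -
  obtain r s t m where I: "I = (*) (1 + r * gen_x) ` N s t m" and r: "r \<in> subalg_R"
    and ranges: "m \<in> {0..1}" "s \<in> {0..1}" "t \<in> {0..5}"
    using assms unfolding indecomposable_right_ideal_iff by blast
  obtain \<gamma> where "r * gen_x = scal \<gamma> (gen_x :: 'k algA)" using gen_x_left_mult_subalg_R[OF r] by blast
  then have "right_module_iso (N s t m) I"
    unfolding I using one_plus_scal_gen_x_inverse(2) right_module_iso_left_mult by metis
  then have "right_module_iso I (N s t m)"
    using right_module_iso_sym indecomposable_N[OF ranges(1)]
    unfolding indecomposable_right_ideal_def by blast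
  then show ?thesis using ranges by blast
qed

end

theorem theorem34:
  fixes \<zeta> :: "'k::field"
  assumes "primitive_root_of_unity 6 \<zeta>"
  shows "(\<forall>s\<in>{0..1}. \<forall>t\<in>{0..5}. \<forall>m\<in>{0..1}. N_ideal \<zeta> s t m \<in> L_in) \<and>
    (\<forall>I\<in>(L_in :: 'k algA set set).
       \<exists>!(s, t, m). (s, t, m) \<in> {0..1} \<times> {0..5} \<times> {0..1} \<and> right_module_iso I (N_ideal \<zeta> s t m)) \<and>
    (L_in :: 'k algA set set) =
      {(\<lambda>u. (1 + r * gen_x) * u) ` N_ideal \<zeta> s t m | r s t m.
         r \<in> subalg_R \<and> m \<in> {0..1} \<and> s \<in> {0..1} \<and> t \<in> {0..5}}"
proof (intro conjI ballI)
  show "N_ideal \<zeta> s t m \<in> L_in" if "m \<in> {0..1}" for s t m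
    using indecomposable_N[OF assms that] by (simp add: L_in_def)
  show "L_in = {(\<lambda>u. (1 + r * gen_x) * u) ` N_ideal \<zeta> s t m | r s t m.
         r \<in> subalg_R \<and> m \<in> {0..1} \<and> s \<in> {0..1} \<and> t \<in> {0..5}}"
    unfolding L_in_def using indecomposable_right_ideal_iff[OF assms] by blast
  fix I :: "'k algA set" assume "I \<in> L_in"
  then have ind: "indecomposable_right_ideal I" by (simp add: L_in_def)
  then have I: "right_ideal I" by (simp add: indecomposable_right_ideal_def)
  let ?P = "\<lambda>(s, t, m). (s, t, m) \<in> {0..1} \<times> {0..5} \<times> {0..1} \<and> right_module_iso I (N_ideal \<zeta> s t m)"
  obtain s t m where stm: "s \<in> {0..1}" "t \<in> {0..5}" "m \<in> {0..1}" "right_module_iso I (N_ideal \<zeta> s t m)"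
    using exists_N_iso[OF assms ind] by blast
  show "\<exists>!p. ?P p"
  proof (rule ex1I[of _ "(s, t, m)"])
    show "?P (s, t, m)" using stm by simp
    fix p assume p: "?P p"
    obtain s' t' m' where p_eq: "p = (s', t', m')" by (cases p)
    have "right_module_iso (N_ideal \<zeta> s' t' m') (N_ideal \<zeta> s t m)"
      using p stm(4) right_module_iso_sym[OF I] right_module_iso_trans unfolding p_eq by blast
    then show "p = (s, t, m)"
      using N_iso_imp_eq[OF assms, of s' s t' t m' m] p stm unfolding p_eq by simp
  qed
qed

end
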